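(* Let $K\ge 1$ be an integer, let $\varepsilon_0>0$, and consider the model $Y_i=m(X_i)+\varepsilon_i$, $i=1,\dots,n$, described in the context, with a fixed function $m$ and fixed conditional law of $\varepsilon_i$ given $X_i$. There exists a constant $C$, not depending on $n$ and depending on $\pi$ only through $\varepsilon_0$ (it may depend on $K$, $m$ and the conditional law of the noise), such that for every probability density $\pi$ on $[-1,1]$ with $\pi(x)>\varepsilon_0$ for all $x\in[-1,1]$ and with $E_\pi(e_1^4)<\infty$, and for all $n\ge 1$, $$ n^{3/2}\left|\int_{-1}^1 \frac12 E_\pi\{\tilde\ell_\pi(x)-\ell(x)\}^2\,dx-\frac1n \operatorname{tr}(Q^{-1}\Omega_\pi)\right|<C .$$
   Context: For $x\in[-1,1]$ let $\vec{x}=(1,x,\dots,x^K)$, a row vector. Let $Q=\int_{-1}^1\frac12\vec{x}^T\vec{x}\,dx$, a $(K+1)\times(K+1)$ matrix. Let $m:[-1,1]\to\mathbb{R}$ be an integrable function, $\beta=Q^{-1}\int_{-1}^1\frac12\vec{x}^T m(x)\,dx$ (a column vector), and $\ell(x)=\vec{x}\beta$ (the best linear approximation of $m$ with respect to the uniform distribution on $[-1,1]$). Model: $\pi$ is a probability density on $[-1,1]$ with respect to Lebesgue measure; $X_1,\dots,X_n$ are sampled independently from $\pi$, and $Y_i=m(X_i)+\varepsilon_i$, where the pairs $(X_i,\varepsilon_i)$ are independent and identically distributed, $E(\varepsilon_i\mid X_i)=0$ (so that $m(x)=E(Y_i\mid X_i=x)$), and $E(\varepsilon_i^2\mid X_i)=\sigma^2$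 for a constant $\sigma^2$. The conditional law of $\varepsilon_i$ given $X_i=x$ does not depend on $\pi$. $E_\pi$, $\mathrm{var}_\pi$ denote expectation and variance (covariance matrix) when $X_i\sim\pi$. Let $\vec{X}_i=(1,X_i,\dots,X_i^K)$ and $e_i=Y_i-\vec{X}_i\beta$. Let $\mathbb{X}\in\mathbb{R}^{n\times(K+1)}$ be the matrix with rows $\vec{X}_i$, $\mathbb{Y}=(Y_1,\dots,Y_n)^T$, and $W_\pi$ the $n\times n$ diagonal matrix with $i$-th diagonal entry $\frac{1/2}{\pi(X_i)}$. With $\lambda_{\min}$ the smallest eigenvalue and $I(\cdot)$ the indicator function, define the event $$\mathcal{E}_\pi=\{\lambda_{\min}(\mathbb{X}^TW_\pi\mathbb{X}/n)<\lambda_{\min}(Q)/2\},$$ $\mathcal{E}_\pi^C$ its complement, and $$\tilde Q_\pi=I(\mathcal{E}_\pi)\,nQ+I(\mathcal{E}_\pi^C)\,\mathbb{X}^TW_\pi\mathbb{X},\qquad \tilde V_\pi=\mathbb{X}^TW_\pi\mathbb{Y},\qquad \tilde\beta_\pi=\tilde Q_\pi^{-1}\tilde V_\pi,\qquad \tilde\ell_\pi(x)=\vec{x}\,\tilde\beta_\pi .$$ Finally, $$\Omega_\pi=\mathrm{var}_\pi\left\{\vec{X}_1^T e_1\frac{1/2}{\pi(X_1)}\right\}=\frac14\int_{-1}^1\vec{x}^T\vec{x}\,\frac{1}{\pi(x)}\left[\sigma^2+\{m(x)-\ell(x)\}^2\right]dx .$$ *)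

theory Defs
  imports
    "HOL-Probability.Probability"
    "Jordan_Normal_Form.Spectral_Radius"
    "Jordan_Normal_Form.Gauss_Jordan_Elimination"
begin

no_notation vec_nth (infixl "$" 90)
no_notation inner (infix "\<bullet>" 70)
hide_const (open) Finite_Cartesian_Product.vec Finite_Cartesian_Product.mat

abbreviation Leb :: "real measure" where
  "Leb \<equiv> lebesgue_on {-1..1}"

abbreviation inv_mat :: "real mat \<Rightarrow> real mat" where
  "inv_mat A \<equiv> the (mat_inverse A)"

definition tr :: "real mat \<Rightarrow> real" where
  "tr A = (\<Sum>i<dim_row A. A $$ (i, i))"

text \<open>Only real eigenvalues enter; this is the smallest eigenvalue for symmetric matrices.\<close>

definition lambda_min :: "real mat \<Rightarrow> real" where
  "lambda_min A = Min (spectrum A)"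

definition cov_mat :: "'a measure \<Rightarrow> nat \<Rightarrow> ('a \<Rightarrow> real vec) \<Rightarrow> real mat" where
  "cov_mat M d Z = mat d d (\<lambda>(i, j).
     (LINT \<omega>|M. (Z \<omega> $ i - (LINT \<omega>'|M. Z \<omega>' $ i)) * (Z \<omega> $ j - (LINT \<omega>'|M. Z \<omega>' $ j))))"


subsection \<open>Best linear approximation under the uniform distribution\<close>

definition powers :: "nat \<Rightarrow> real \<Rightarrow> real vec" where
  "powers K x = vec (K + 1) (\<lambda>j. x ^ j)"

definition Q_mat :: "nat \<Rightarrow> real mat" where
  "Q_mat K = mat (K + 1) (K + 1)
     (\<lambda>(i, j). LINT x|Leb. 1/2 * (powers K x $ i * powers K x $ j))"

definition beta :: "nat \<Rightarrow> (real \<Rightarrow> real) \<Rightarrow> real vec" where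
  "beta K m = inv_mat (Q_mat K) *\<^sub>v vec (K + 1) (\<lambda>j. LINT x|Leb. 1/2 * (powers K x $ j * m x))"

definition ell :: "nat \<Rightarrow> (real \<Rightarrow> real) \<Rightarrow> real \<Rightarrow> real" where
  "ell K m x = powers K x \<bullet> beta K m"


subsection \<open>The model\<close>

text \<open>The kernel \<open>\<kappa>\<close> gives the conditional law \<open>\<kappa> x\<close> of the noise given that the
  covariate equals \<open>x\<close>. Conditional moments are only determined almost everywhere; since all
  design densities considered are bounded away from zero on \<open>[-1,1]\<close>, the null sets of the
  covariate are exactly the Lebesgue null sets.\<close>

definition noise_kernel :: "(real \<Rightarrow> real measure) \<Rightarrow> real \<Rightarrow> bool" where
  "noise_kernel \<kappa> \<sigma> \<longleftrightarrow>
     \<kappa> \<in> Leb \<rightarrow>\<^sub>M prob_algebra borel \<and>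
     (AE x in Leb. has_bochner_integral (\<kappa> x) (\<lambda>e. e) 0) \<and>
     (AE x in Leb. has_bochner_integral (\<kappa> x) (\<lambda>e. e\<^sup>2) (\<sigma>\<^sup>2))"

definition density_on_interval :: "(real \<Rightarrow> real) \<Rightarrow> bool" where
  "density_on_interval p \<longleftrightarrow> (\<forall>x\<in>{-1..1}. 0 \<le> p x) \<and> has_bochner_integral Leb p 1"

text \<open>The law of a pair (covariate, noise), and the law of \<open>n\<close> independent copies of it. A sample
  point \<open>\<omega>\<close> gives the data \<open>(X\<^sub>i, \<epsilon>\<^sub>i) = \<omega> i\<close>, \<open>i < n\<close>.\<close>

definition pair_law :: "(real \<Rightarrow> real) \<Rightarrow> (real \<Rightarrow> real measure) \<Rightarrow> (real \<times> real) measure" where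
  "pair_law p \<kappa> = density Leb p \<bind>
     (\<lambda>x. \<kappa> x \<bind> (\<lambda>e. return (Leb \<Otimes>\<^sub>M borel) (x, e)))"

definition sample_law ::
  "(real \<Rightarrow> real) \<Rightarrow> (real \<Rightarrow> real measure) \<Rightarrow> nat \<Rightarrow> (nat \<Rightarrow> real \<times> real) measure" where
  "sample_law p \<kappa> n = (\<Pi>\<^sub>M i\<in>{..<n}. pair_law p \<kappa>)"

definition response :: "(real \<Rightarrow> real) \<Rightarrow> real \<times> real \<Rightarrow> real" where
  "response m = (\<lambda>(x, e). m x + e)"

definition resid :: "nat \<Rightarrow> (real \<Rightarrow> real) \<Rightarrow> real \<times> real \<Rightarrow> real" where
  "resid K m z = response m z - powers K (fst z) \<bullet> beta K m"

definition Omega ::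
  "nat \<Rightarrow> (real \<Rightarrow> real) \<Rightarrow> (real \<Rightarrow> real measure) \<Rightarrow> (real \<Rightarrow> real) \<Rightarrow> real mat" where
  "Omega K m \<kappa> p = cov_mat (pair_law p \<kappa>) (K + 1)
     (\<lambda>z. (resid K m z * ((1/2) / p (fst z))) \<cdot>\<^sub>v powers K (fst z))"


subsection \<open>The weighted least squares estimator\<close>

definition design :: "nat \<Rightarrow> nat \<Rightarrow> (nat \<Rightarrow> real \<times> real) \<Rightarrow> real mat" where
  "design K n \<omega> = mat n (K + 1) (\<lambda>(i, j). powers K (fst (\<omega> i)) $ j)"

definition responses :: "(real \<Rightarrow> real) \<Rightarrow> nat \<Rightarrow> (nat \<Rightarrow> real \<times> real) \<Rightarrow> real vec" where
  "responses m n \<omega> = vec n (\<lambda>i. response m (\<omega> i))"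

definition weights :: "(real \<Rightarrow> real) \<Rightarrow> nat \<Rightarrow> (nat \<Rightarrow> real \<times> real) \<Rightarrow> real mat" where
  "weights p n \<omega> = mat_diag n (\<lambda>i. (1/2) / p (fst (\<omega> i)))"

definition gram :: "nat \<Rightarrow> (real \<Rightarrow> real) \<Rightarrow> nat \<Rightarrow> (nat \<Rightarrow> real \<times> real) \<Rightarrow> real mat" where
  "gram K p n \<omega> = (design K n \<omega>)\<^sup>T * weights p n \<omega> * design K n \<omega>"

definition bad_event :: "nat \<Rightarrow> (real \<Rightarrow> real) \<Rightarrow> nat \<Rightarrow> (nat \<Rightarrow> real \<times> real) set" where
  "bad_event K p n =
     {\<omega>. lambda_min ((1 / real n) \<cdot>\<^sub>m gram K p n \<omega>) < lambda_min (Q_mat K) / 2}"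

definition Q_tilde :: "nat \<Rightarrow> (real \<Rightarrow> real) \<Rightarrow> nat \<Rightarrow> (nat \<Rightarrow> real \<times> real) \<Rightarrow> real mat" where
  "Q_tilde K p n \<omega> =
     (if \<omega> \<in> bad_event K p n then real n \<cdot>\<^sub>m Q_mat K else gram K p n \<omega>)"

definition V_tilde ::
  "nat \<Rightarrow> (real \<Rightarrow> real) \<Rightarrow> (real \<Rightarrow> real) \<Rightarrow> nat \<Rightarrow> (nat \<Rightarrow> real \<times> real) \<Rightarrow> real vec" where
  "V_tilde K m p n \<omega> = ((design K n \<omega>)\<^sup>T * weights p n \<omega>) *\<^sub>v responses m n \<omega>"

definition beta_tilde ::
  "nat \<Rightarrow> (real \<Rightarrow> real) \<Rightarrow> (real \<Rightarrow> real) \<Rightarrow> nat \<Rightarrow> (nat \<Rightarrow> real \<times> real) \<Rightarrow> real vec" where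
  "beta_tilde K m p n \<omega> = inv_mat (Q_tilde K p n \<omega>) *\<^sub>v V_tilde K m p n \<omega>"

definition ell_tilde ::
  "nat \<Rightarrow> (real \<Rightarrow> real) \<Rightarrow> (real \<Rightarrow> real) \<Rightarrow> nat \<Rightarrow> (nat \<Rightarrow> real \<times> real) \<Rightarrow> real \<Rightarrow> real" where
  "ell_tilde K m p n \<omega> x = powers K x \<bullet> beta_tilde K m p n \<omega>"

end

theory Submission
  imports Defs
begin

text \<open>Write \<open>b\<close> for the error of the estimated coefficients, \<open>S\<close> for the weighted
Gram matrix divided by \<open>n\<close>, and \<open>U\<close> for the mean over the sample of the score
\<open>x\<^sup>j e (1/2) / p(x)\<close>. Both \<open>U\<close> and \<open>S - Q\<close> are sample means of centred variables, and the
integrated squared error is the quadratic form \<open>b\<^sup>T Q b\<close>. To first order \<open>b\<close> is \<open>Q\<^sup>-\<^sup>1 U\<close>, so the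
error is \<open>U\<^sup>T Q\<^sup>-\<^sup>1 U\<close>, whose expectation is exactly \<open>tr (Q\<^sup>-\<^sup>1 \<Omega>) / n\<close>. Everything rests on bounding the
remainder \<open>b\<^sup>T Q b - U\<^sup>T Q\<^sup>-\<^sup>1 U\<close> for each sample separately, by a constant times \<open>r\<^sup>3\<close>, where
\<open>r\<close> is the sum of the absolute values of all entries of \<open>U\<close> and \<open>S - Q\<close>.

Outside the bad event, \<open>S b = U\<close> and \<open>S\<close> is coercive with constant \<open>c = \<lambda>\<^sub>m\<^sub>i\<^sub>n(Q)/2\<close>. Eliminating \<open>U\<close> leaves only
terms \<open>u\<^sup>T (S - Q) b\<close> with \<open>u\<close> and \<open>b\<close> of size \<open>r / c\<close>, which are cubic
(\<open>coercive_system_expansion\<close>). On the bad event \<open>Q b = U + (S - Q) \<beta>\<close>, and the remainder is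
only quadratic in \<open>r\<close>. But there \<open>S\<close> has lost half of the coercivity of \<open>Q\<close>, which forces \<open>r \<ge> c\<close>,
so that \<open>r\<^sup>2 \<le> r\<^sup>3 / c\<close> (\<open>fallback_system_expansion\<close>). One cubic bound thus serves both events.

It remains to see that \<open>n\<^sup>3\<^sup>/\<^sup>2 E r\<^sup>3\<close> is bounded. Since \<open>t\<^sup>3 \<le> 1 + t\<^sup>4\<close> for \<open>t = n\<^sup>1\<^sup>/\<^sup>2 r\<close>, it is enough that
\<open>n\<^sup>2 E r\<^sup>4\<close> is, which is the classical bound for the fourth moment of a mean of independent centred
variables (\<open>sample_mean_moments\<close>). The bounds are uniform in the design density because \<open>p > \<epsilon>\<close>: the
entries of the Gram matrix are averages of bounded variables, and a score has fourth moment at most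
\<open>\<epsilon>\<^sup>-\<^sup>3 / 16\<close> times \<open>\<integral> E(e\<^sup>4 | X = x) dx\<close> (\<open>score_fourth\<close>), an integral in which \<open>p\<close> does not occur.

Two facts about symmetric matrices are needed on the way: the smallest eigenvalue is the minimum of
the Rayleigh quotient (\<open>lambda_min_rayleigh\<close>), which turns the bad event into a
statement about quadratic forms, and rational vectors already decide that statement
(\<open>rational_quadratic_witness\<close>), which makes the bad event measurable. Measurability of the
estimator also uses that the inverse is the adjugate divided by the determinant.\<close>

section \<open>Perturbation of a quadratic form\<close>

text \<open>Vectors and matrices are functions of indices, of which only those below \<open>d\<close> count; this keeps the
perturbation argument free of dimension side conditions.\<close>

definition dot :: "nat \<Rightarrow> (nat \<Rightarrow> real) \<Rightarrow> (nat \<Rightarrow> real) \<Rightarrow> real" where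
  "dot d u v = (\<Sum>i<d. u i * v i)"

definition bilin :: "nat \<Rightarrow> (nat \<Rightarrow> nat \<Rightarrow> real) \<Rightarrow> (nat \<Rightarrow> real) \<Rightarrow> (nat \<Rightarrow> real) \<Rightarrow> real" where
  "bilin d A u v = (\<Sum>i<d. \<Sum>j<d. u i * A i j * v j)"

lemma bilin_eq_dot:
  assumes "\<forall>i<d. (\<Sum>j<d. A i j * v j) = w i"
  shows "bilin d A u v = dot d u w"
  unfolding bilin_def dot_def
  by (intro sum.cong refl) (simp add: assms[rule_format, symmetric] sum_distrib_left mult.assoc)

lemma bilin_sym:
  assumes "\<forall>i<d. \<forall>j<d. A i j = A j i"
  shows "bilin d A u v = bilin d A v u"
  unfolding bilin_def
  by (subst sum.swap) (intro sum.cong refl, simp add: assms mult_ac)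

lemma bilin_diff_mat: "bilin d (\<lambda>i j. A i j - B i j) u v = bilin d A u v - bilin d B u v"
  unfolding bilin_def by (simp add: algebra_simps sum_subtractf)

lemma bilin_add_left: "bilin d A (\<lambda>i. u i + v i) w = bilin d A u w + bilin d A v w"
  unfolding bilin_def by (simp add: algebra_simps sum.distrib)

lemma bilin_add_right: "bilin d A w (\<lambda>i. u i + v i) = bilin d A w u + bilin d A w v"
  unfolding bilin_def by (simp add: algebra_simps sum.distrib)

lemma bilin_scale_left: "bilin d A (\<lambda>i. t * u i) w = t * bilin d A u w"
  unfolding bilin_def by (simp add: sum_distrib_left mult_ac)

lemma bilin_scale_right: "bilin d A w (\<lambda>i. t * u i) = t * bilin d A w u"
  unfolding bilin_def by (simp add: sum_distrib_left mult_ac)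

lemma dot_commute: "dot d u v = dot d v u"
  unfolding dot_def by (simp add: mult.commute)

lemma dot_add_left: "dot d (\<lambda>i. u i + v i) w = dot d u w + dot d v w"
  unfolding dot_def by (simp add: algebra_simps sum.distrib)

lemma dot_add_right: "dot d w (\<lambda>i. u i + v i) = dot d w u + dot d w v"
  unfolding dot_def by (simp add: algebra_simps sum.distrib)

lemma dot_scale_left: "dot d (\<lambda>i. t * u i) w = t * dot d u w"
  unfolding dot_def by (simp add: sum_distrib_left mult_ac)

lemma dot_scale_right: "dot d w (\<lambda>i. t * u i) = t * dot d w u"
  unfolding dot_def by (simp add: sum_distrib_left mult_ac)

lemma dot_self_nonneg: "0 \<le> dot d u u"
  unfolding dot_def by (intro sum_nonneg) simp

lemma square_le_dot_self: "i < d \<Longrightarrow> (u i)\<^sup>2 \<le> dot d u u"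
  unfolding dot_def power2_eq_square
  by (rule member_le_sum[of i "{..<d}" "\<lambda>i. u i * u i"]) auto

lemma abs_dot_le:
  assumes "\<forall>i<d. \<bar>u i\<bar> \<le> M"
  shows "\<bar>dot d u w\<bar> \<le> M * (\<Sum>i<d. \<bar>w i\<bar>)"
proof -
  have "\<bar>dot d u w\<bar> \<le> (\<Sum>i<d. \<bar>u i\<bar> * \<bar>w i\<bar>)"
    unfolding dot_def by (rule order_trans[OF sum_abs]) (simp add: abs_mult)
  also have "\<dots> \<le> (\<Sum>i<d. M * \<bar>w i\<bar>)"
    by (intro sum_mono mult_right_mono) (auto simp: assms)
  finally show ?thesis by (simp add: sum_distrib_left)
qed

lemma abs_bilin_le:
  assumes "\<forall>i<d. \<bar>u i\<bar> \<le> M" "\<forall>i<d. \<bar>v i\<bar> \<le> N" "0 \<le> M"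
  shows "\<bar>bilin d A u v\<bar> \<le> M * N * (\<Sum>i<d. \<Sum>j<d. \<bar>A i j\<bar>)"
proof -
  have "\<bar>bilin d A u v\<bar> \<le> (\<Sum>i<d. \<Sum>j<d. \<bar>u i\<bar> * \<bar>A i j\<bar> * \<bar>v j\<bar>)"
    unfolding bilin_def
    by (rule order_trans[OF sum_abs sum_mono], rule order_trans[OF sum_abs]) (simp add: abs_mult)
  also have "\<dots> \<le> (\<Sum>i<d. \<Sum>j<d. M * \<bar>A i j\<bar> * N)"
    by (intro sum_mono mult_mono) (auto simp: assms)
  finally show ?thesis by (simp add: sum_distrib_left mult_ac)
qed

text \<open>Testing \<open>S b = U\<close> with \<open>b\<close> gives \<open>c |b|\<^sup>2 \<le> b \<bullet> U \<le> |b| \<Sum>|U\<^sub>i|\<close> in the Euclidean norm, which dominates each entry.\<close>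

lemma coercive_solution_bound:
  assumes "c > 0" and coer: "\<And>v. c * dot d v v \<le> bilin d S v v"
    and sol: "\<forall>i<d. (\<Sum>j<d. S i j * b j) = U i" and i: "i < d"
  shows "\<bar>b i\<bar> \<le> (\<Sum>i<d. \<bar>U i\<bar>) / c"
proof -
  define s where "s = sqrt (dot d b b)"
  have s2: "s\<^sup>2 = dot d b b" unfolding s_def by (simp add: dot_self_nonneg)
  have bs: "\<forall>i<d. \<bar>b i\<bar> \<le> s"
    unfolding s_def using square_le_dot_self by (intro allI impI real_le_rsqrt) simp
  have "c * s\<^sup>2 \<le> dot d b U"
    unfolding s2 using coer[of b] bilin_eq_dot[OF sol] by simp
  also have "\<dots> \<le> s * (\<Sum>i<d. \<bar>U i\<bar>)"
    using abs_dot_le[OF bs, where w=U] by linarith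
  finally have *: "s * (c * s) \<le> s * (\<Sum>i<d. \<bar>U i\<bar>)" by (simp add: power2_eq_square mult_ac)
  have "s \<le> (\<Sum>i<d. \<bar>U i\<bar>) / c"
  proof (cases "s > 0")
    case True
    with * have "c * s \<le> (\<Sum>i<d. \<bar>U i\<bar>)" by simp
    then show ?thesis using \<open>c > 0\<close> by (simp add: field_simps)
  next
    case False
    moreover have "0 \<le> (\<Sum>i<d. \<bar>U i\<bar>) / c" using \<open>c > 0\<close> by (simp add: sum_nonneg)
    ultimately show ?thesis by linarith
  qed
  with bs i show ?thesis by (meson order_trans)
qed

text \<open>The direction \<open>v\<close> in which \<open>S\<close> fails to reach half of the coercivity of \<open>Q\<close> exhibits a large entry sum of \<open>S - Q\<close>.\<close>

lemma lost_coercivity_perturbation: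
  assumes "\<And>v. 2 * c * dot d v v \<le> bilin d Q v v" and "bilin d S v v < c * dot d v v"
  shows "c \<le> (\<Sum>i<d. \<Sum>j<d. \<bar>S i j - Q i j\<bar>)"
proof -
  let ?N = "\<Sum>i<d. \<Sum>j<d. \<bar>S i j - Q i j\<bar>"
  define s where "s = sqrt (dot d v v)"
  have s2: "s * s = dot d v v" unfolding s_def by (simp add: dot_self_nonneg)
  have vs: "\<forall>i<d. \<bar>v i\<bar> \<le> s"
    unfolding s_def using square_le_dot_self by (intro allI impI real_le_rsqrt) simp
  have "0 \<le> s" unfolding s_def by (simp add: dot_self_nonneg)
  have "c * dot d v v < bilin d Q v v - bilin d S v v" using assms(1)[of v] assms(2) by linarith
  also have "\<dots> \<le> s * s * ?N"
    using abs_bilin_le[OF vs vs \<open>0 \<le> s\<close>, where A="\<lambda>i j. S i j - Q i j"]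
    unfolding bilin_diff_mat by linarith
  finally have "c * dot d v v < ?N * dot d v v" by (simp add: s2 mult.commute)
  then show ?thesis using dot_self_nonneg[of d v]
    by (meson less_eq_real_def linorder_not_less mult_right_mono)
qed

text \<open>With \<open>\<Delta> = S - Q\<close>, symmetry of \<open>Q\<close> gives the exact identity
\<open>b\<^sup>T Q b - q\<^sup>T U = - q\<^sup>T \<Delta> b - b\<^sup>T \<Delta> b\<close>, and both terms on the right are products of three small factors.\<close>

lemma coercive_system_expansion:
  assumes sym: "\<forall>i<d. \<forall>j<d. Q i j = Q j i"
    and q: "\<forall>i<d. (\<Sum>j<d. Q i j * q j) = U i"
    and b: "\<forall>i<d. (\<Sum>j<d. S i j * b j) = U i"
    and c: "c > 0" "\<And>v. c * dot d v v \<le> bilin d Q v v" "\<And>v. c * dot d v v \<le> bilin d S v v"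
    and r: "r = (\<Sum>i<d. \<bar>U i\<bar>) + (\<Sum>i<d. \<Sum>j<d. \<bar>S i j - Q i j\<bar>)"
  shows "\<bar>bilin d Q b b - dot d q U\<bar> \<le> 2 / c\<^sup>2 * r ^ 3" and "i < d \<Longrightarrow> \<bar>b i\<bar> \<le> r / c"
proof -
  let ?\<Delta> = "\<lambda>i j. S i j - Q i j"
  have U: "(\<Sum>i<d. \<bar>U i\<bar>) \<le> r" and D: "(\<Sum>i<d. \<Sum>j<d. \<bar>?\<Delta> i j\<bar>) \<le> r" and r0: "0 \<le> r"
    unfolding r by (auto intro!: sum_nonneg add_nonneg_nonneg)
  have Uc: "(\<Sum>i<d. \<bar>U i\<bar>) / c \<le> r / c" using U c(1) by (simp add: divide_right_mono)
  have bb: "\<forall>i<d. \<bar>b i\<bar> \<le> r / c"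
    using coercive_solution_bound[OF c(1,3) b] Uc order_trans by blast
  then show "i < d \<Longrightarrow> \<bar>b i\<bar> \<le> r / c" by simp
  have qb: "\<forall>i<d. \<bar>q i\<bar> \<le> r / c"
    using coercive_solution_bound[OF c(1,2) q] Uc order_trans by blast
  have rc: "0 \<le> r / c" using r0 c(1) by simp
  have bd: "\<bar>bilin d ?\<Delta> u b\<bar> \<le> r ^ 3 / c\<^sup>2" if "\<forall>i<d. \<bar>u i\<bar> \<le> r / c" for u
  proof -
    have "\<bar>bilin d ?\<Delta> u b\<bar> \<le> r / c * (r / c) * (\<Sum>i<d. \<Sum>j<d. \<bar>?\<Delta> i j\<bar>)"
      by (rule abs_bilin_le[OF that bb rc])
    also have "\<dots> \<le> r / c * (r / c) * r" by (rule mult_left_mono[OF D]) (use rc in simp)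
    finally show ?thesis by (simp add: power2_eq_square power3_eq_cube)
  qed
  have "bilin d Q b b = dot d b U - bilin d ?\<Delta> b b"
    using bilin_diff_mat[of d S Q b b] bilin_eq_dot[OF b, where u=b] by linarith
  moreover have "dot d b U = dot d q U - bilin d ?\<Delta> q b"
    using bilin_diff_mat[of d S Q q b] bilin_eq_dot[OF b, where u=q] bilin_eq_dot[OF q, where u=b]
      bilin_sym[OF sym, of q b] by linarith
  ultimately have "bilin d Q b b - dot d q U = - bilin d ?\<Delta> q b - bilin d ?\<Delta> b b" by linarith
  moreover have "2 / c\<^sup>2 * r ^ 3 = r ^ 3 / c\<^sup>2 + r ^ 3 / c\<^sup>2" by simp
  ultimately show "\<bar>bilin d Q b b - dot d q U\<bar> \<le> 2 / c\<^sup>2 * r ^ 3"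
    using bd[OF qb] bd[OF bb] by linarith
qed

text \<open>Here \<open>b = q + h\<close> with \<open>Q h = \<Delta> \<beta>\<close>, and \<open>b\<^sup>T Q b - q\<^sup>T U = 2 h\<^sup>T U + h\<^sup>T \<Delta> \<beta>\<close> is only quadratic in \<open>r\<close>. The missing
factor comes from \<open>c \<le> r\<close>, which holds because \<open>S\<close> fails to be coercive.\<close>

lemma fallback_system_expansion:
  assumes sym: "\<forall>i<d. \<forall>j<d. Q i j = Q j i"
    and q: "\<forall>i<d. (\<Sum>j<d. Q i j * q j) = U i"
    and b: "\<forall>i<d. (\<Sum>j<d. Q i j * b j) = U i + (\<Sum>j<d. (S i j - Q i j) * \<beta> j)"
    and c: "c > 0" "\<And>v. 2 * c * dot d v v \<le> bilin d Q v v"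
    and bad: "bilin d S v v < c * dot d v v"
    and r: "r = (\<Sum>i<d. \<bar>U i\<bar>) + (\<Sum>i<d. \<Sum>j<d. \<bar>S i j - Q i j\<bar>)"
    and B: "B = (\<Sum>i<d. \<bar>\<beta> i\<bar>)"
  shows "\<bar>bilin d Q b b - dot d q U\<bar> \<le> B * (2 + B) / c\<^sup>2 * r ^ 3"
    and "i < d \<Longrightarrow> \<bar>b i\<bar> \<le> (1 + B) * r / c"
proof -
  let ?\<Delta> = "\<lambda>i j. S i j - Q i j"
  define g where "g i = (\<Sum>j<d. ?\<Delta> i j * \<beta> j)" for i
  define h where "h i = b i - q i" for i
  have h: "\<forall>i<d. (\<Sum>j<d. Q i j * h j) = g i"
    using b q unfolding h_def g_def by (simp add: algebra_simps sum_subtractf)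
  have U: "(\<Sum>i<d. \<bar>U i\<bar>) \<le> r" and D: "(\<Sum>i<d. \<Sum>j<d. \<bar>?\<Delta> i j\<bar>) \<le> r" and r0: "0 \<le> r"
    unfolding r by (auto intro!: sum_nonneg add_nonneg_nonneg)
  have B0: "0 \<le> B" unfolding B by (simp add: sum_nonneg)
  have c2: "c * dot d v v \<le> bilin d Q v v" for v
    using c(2)[of v] mult_nonneg_nonneg[OF less_imp_le[OF c(1)] dot_self_nonneg[of d v]] by linarith
  have \<beta>B: "\<bar>\<beta> i\<bar> \<le> B" if "i < d" for i
    unfolding B using that by (intro member_le_sum) auto
  have gr: "(\<Sum>i<d. \<bar>g i\<bar>) \<le> B * r"
  proof -
    have "(\<Sum>i<d. \<bar>g i\<bar>) \<le> (\<Sum>i<d. \<Sum>j<d. \<bar>?\<Delta> i j\<bar> * B)"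
      unfolding g_def
      by (intro sum_mono order_trans[OF sum_abs]) (simp add: abs_mult mult_left_mono \<beta>B)
    also have "\<dots> = B * (\<Sum>i<d. \<Sum>j<d. \<bar>?\<Delta> i j\<bar>)" by (simp add: sum_distrib_left mult.commute)
    also have "\<dots> \<le> B * r" by (rule mult_left_mono[OF D B0])
    finally show ?thesis .
  qed
  have hb: "\<forall>i<d. \<bar>h i\<bar> \<le> B * r / c"
    using coercive_solution_bound[OF c(1) c2 h] divide_right_mono[OF gr, of c] c(1) by (meson less_imp_le order_trans)
  have qb: "\<forall>i<d. \<bar>q i\<bar> \<le> r / c"
    using coercive_solution_bound[OF c(1) c2 q] divide_right_mono[OF U, of c] c(1) by (meson less_imp_le order_trans)
  have bh: "b = (\<lambda>i. q i + h i)" unfolding h_def by simp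
  show "i < d \<Longrightarrow> \<bar>b i\<bar> \<le> (1 + B) * r / c"
  proof -
    assume "i < d"
    have "\<bar>b i\<bar> \<le> r / c + B * r / c" using hb[rule_format, OF \<open>i < d\<close>] qb[rule_format, OF \<open>i < d\<close>] unfolding bh by linarith
    then show ?thesis by (simp add: add_divide_distrib algebra_simps)
  qed
  have e1: "bilin d Q h h = dot d h g" by (rule bilin_eq_dot[OF h])
  have e2: "bilin d Q h q = dot d h U" by (rule bilin_eq_dot[OF q])
  have e3: "bilin d Q q h = dot d h U" using e2 bilin_sym[OF sym, of q h] by simp
  have e4: "bilin d Q q q = dot d q U" by (rule bilin_eq_dot[OF q])
  have "bilin d Q b b - dot d q U = 2 * dot d h U + dot d h g"
    unfolding bh bilin_add_left bilin_add_right e1 e2 e3 e4 by simp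
  moreover have "\<bar>dot d h U\<bar> \<le> B * r / c * r"
    using abs_dot_le[OF hb, where w=U] mult_left_mono[OF U, of "B * r / c"] B0 r0 c(1) by simp
  moreover have "\<bar>dot d h g\<bar> \<le> B * r / c * (B * r)"
    using abs_dot_le[OF hb, where w=g] mult_left_mono[OF gr, of "B * r / c"] B0 r0 c(1) by simp
  ultimately have "\<bar>bilin d Q b b - dot d q U\<bar> \<le> 2 * (B * r / c * r) + B * r / c * (B * r)"
    by linarith
  also have "\<dots> = B * (2 + B) / c\<^sup>2 * (c * r\<^sup>2)"
    using c(1) by (simp add: field_simps power2_eq_square)
  also have "\<dots> \<le> B * (2 + B) / c\<^sup>2 * (r * r\<^sup>2)"
    using lost_coercivity_perturbation[OF c(2) bad] D B0 r0 c(1)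
    by (intro mult_left_mono mult_right_mono) auto
  finally show "\<bar>bilin d Q b b - dot d q U\<bar> \<le> B * (2 + B) / c\<^sup>2 * r ^ 3"
    by (simp add: power2_eq_square power3_eq_cube)
qed


section \<open>The smallest eigenvalue of a symmetric matrix\<close>

abbreviation entries :: "real mat \<Rightarrow> nat \<Rightarrow> nat \<Rightarrow> real" where
  "entries A \<equiv> \<lambda>i j. A $$ (i, j)"

lemma mult_mat_vec_entry:
  assumes "A \<in> carrier_mat d d" "v \<in> carrier_vec d" "i < d"
  shows "(A *\<^sub>v v) $ i = (\<Sum>j<d. A $$ (i, j) * v $ j)"
  using assms by (auto simp: scalar_prod_def atLeast0LessThan intro!: sum.cong)

text \<open>Setting the coordinates from \<open>d\<close> on to zero embeds the sphere of dimension \<open>d - 1\<close> in the function space, where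
Tychonoff's theorem supplies compactness for a dimension that is a number and not a type.\<close>

lemma compact_unit_sphere: "compact {f :: nat \<Rightarrow> real. dot d f f = 1 \<and> (\<forall>i\<ge>d. f i = 0)}"
proof -
  let ?B = "\<Pi>\<^sub>E i\<in>UNIV. (if i < d then {-1..1} else {0}) :: real set"
  have "compactin (product_topology (\<lambda>_. euclidean) UNIV) ?B"
    by (subst compactin_PiE) auto
  then have "compact ?B" by (simp add: euclidean_product_topology)
  moreover have "closed {f :: nat \<Rightarrow> real. dot d f f = 1}"
    unfolding dot_def
    by (intro closed_Collect_eq continuous_intros continuous_on_product_coordinates)
  ultimately have "compact (?B \<inter> {f. dot d f f = 1})" by (rule compact_Int_closed)
  moreover have "?B \<inter> {f. dot d f f = 1} = {f. dot d f f = 1 \<and> (\<forall>i\<ge>d. f i = 0)}"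
  proof (intro Set.set_eqI iffI)
    fix f :: "nat \<Rightarrow> real" assume "f \<in> {f. dot d f f = 1 \<and> (\<forall>i\<ge>d. f i = 0)}"
    then have f: "dot d f f = 1" "\<forall>i\<ge>d. f i = 0" by auto
    have "f i \<in> {-1..1}" if "i < d" for i
      using square_le_dot_self[OF that, of f] f(1) by (simp add: abs_square_le_1 abs_le_iff)
    with f show "f \<in> ?B \<inter> {f. dot d f f = 1}" by (auto simp: PiE_iff)
  next
    fix f :: "nat \<Rightarrow> real" assume f: "f \<in> ?B \<inter> {f. dot d f f = 1}"
    then have "f i \<in> (if i < d then {-1..1} else {0})" for i by blast
    then have "f i = 0" if "i \<ge> d" for i using that by (metis not_less singletonD)
    with f show "f \<in> {f. dot d f f = 1 \<and> (\<forall>i\<ge>d. f i = 0)}" by auto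
  qed
  ultimately show ?thesis by simp
qed

lemma rayleigh_minimizer:
  assumes "d > 0"
  obtains g where "dot d g g = 1" "\<And>v. bilin d A g g * dot d v v \<le> bilin d A v v"
proof -
  let ?S = "{f :: nat \<Rightarrow> real. dot d f f = 1 \<and> (\<forall>i\<ge>d. f i = 0)}"
  have "(\<lambda>i. if i = 0 then 1 else 0) \<in> ?S"
    using assms unfolding dot_def by (auto simp: if_distrib[of "\<lambda>x. x * _"] cong: if_cong)
  then have "?S \<noteq> {}" by blast
  moreover have "continuous_on ?S (\<lambda>f. bilin d A f f)"
    unfolding bilin_def
    by (intro continuous_intros continuous_on_subset[OF continuous_on_product_coordinates]) auto
  ultimately obtain g where g: "g \<in> ?S" and min: "\<And>f. f \<in> ?S \<Longrightarrow> bilin d A g g \<le> bilin d A f f"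
    using continuous_attains_inf[OF compact_unit_sphere, of d "\<lambda>f. bilin d A f f"] by blast
  have "bilin d A g g * dot d v v \<le> bilin d A v v" for v
  proof (cases "dot d v v = 0")
    case True
    then have "\<forall>i<d. v i = 0"
      using square_le_dot_self[of _ d v] by (metis power2_less_eq_zero_iff)
    then have "bilin d A v v = 0" unfolding bilin_def by simp
    with True show ?thesis by simp
  next
    case False
    define s where "s = sqrt (dot d v v)"
    have s: "s > 0" "s * s = dot d v v"
      using False dot_self_nonneg[of d v] unfolding s_def by auto
    define w where "w i = (1 / s) * (if i < d then v i else 0)" for i
    have eqs: "dot d w w = (1 / s) * ((1 / s) * dot d v v)" "bilin d A w w = (1 / s) * ((1 / s) * bilin d A v v)"
      unfolding w_def dot_scale_left dot_scale_right bilin_scale_left bilin_scale_right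
      unfolding dot_def bilin_def by simp_all
    have "w \<in> ?S" using eqs(1) s unfolding w_def by (auto simp: field_simps)
    moreover have "dot d v v > 0" using s by (metis mult_pos_pos)
    ultimately show ?thesis using min[of w] eqs(2) s by (simp add: field_simps)
  qed
  with g that show ?thesis by blast
qed

text \<open>First-order condition at a minimizer \<open>g\<close>: along \<open>g + t h\<close> the excess of the form over \<open>\<mu>\<close> times the squared norm is
\<open>2 t a + t\<^sup>2 b \<ge> 0\<close> for all \<open>t\<close>, hence \<open>a = 0\<close>. Taking \<open>h\<close> to be a unit vector reads off one row of \<open>A g = \<mu> g\<close>.\<close>

lemma rayleigh_minimizer_eigen:
  assumes sym: "\<forall>i<d. \<forall>j<d. A i j = A j i"
    and g: "dot d g g = 1" and min: "\<And>v. bilin d A g g * dot d v v \<le> bilin d A v v"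
    and i: "i < d"
  shows "(\<Sum>j<d. A i j * g j) = bilin d A g g * g i"
proof -
  let ?\<mu> = "bilin d A g g"
  define h :: "nat \<Rightarrow> real" where "h k = (if k = i then 1 else 0)" for k
  have hA: "bilin d A h g = (\<Sum>j<d. A i j * g j)"
  proof -
    have "bilin d A h g = (\<Sum>k<d. if k = i then (\<Sum>j<d. A k j * g j) else 0)"
      unfolding bilin_def h_def by (intro sum.cong refl) auto
    then show ?thesis using i by (simp add: sum.delta)
  qed
  have hg: "dot d h g = g i"
    unfolding dot_def h_def using i by (simp add: if_distrib[of "\<lambda>x. x * _"] cong: if_cong)
  define a where "a = bilin d A h g - ?\<mu> * dot d h g"
  define b where "b = bilin d A h h - ?\<mu> * dot d h h"
  have q: "0 \<le> 2 * t * a + t * t * b" for t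
  proof -
    let ?v = "\<lambda>k. g k + t * h k"
    have "bilin d A ?v ?v = ?\<mu> + 2 * t * bilin d A h g + t * t * bilin d A h h"
      unfolding bilin_add_left bilin_add_right bilin_scale_left bilin_scale_right
      using bilin_sym[OF sym, of g h] by (simp add: algebra_simps)
    moreover have "dot d ?v ?v = 1 + 2 * t * dot d h g + t * t * dot d h h"
      unfolding dot_add_left dot_add_right dot_scale_left dot_scale_right
      using g dot_commute[of d g h] by (simp add: algebra_simps)
    ultimately show ?thesis
      using min[of ?v] unfolding a_def b_def by (simp add: algebra_simps)
  qed
  have "a = 0"
  proof (rule ccontr)
    assume "a \<noteq> 0"
    define B where "B = \<bar>b\<bar> + 1"
    have B: "B > 0" "b < B" unfolding B_def by auto
    \<comment> \<open>with \<open>t = - a / B\<close> the linear term wins as soon as \<open>b < 2 B\<close>\<close>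
    have "0 \<le> 2 * (- a / B) * a + (- a / B) * (- a / B) * b" by (rule q)
    also have "\<dots> = a\<^sup>2 / B * (b / B - 2)" using B(1) by (simp add: power2_eq_square field_simps)
    finally have "0 \<le> a\<^sup>2 / B * (b / B - 2)" .
    moreover have "a\<^sup>2 / B > 0" using B \<open>a \<noteq> 0\<close> by simp
    moreover have "b / B < 1" using B by simp
    ultimately show False using mult_pos_neg[of "a\<^sup>2 / B" "b / B - 2"] by linarith
  qed
  then show ?thesis using hA hg unfolding a_def by simp
qed

text \<open>The minimum of the Rayleigh quotient is an eigenvalue by the first-order condition, and no
eigenvalue is smaller because an eigenvector has its eigenvalue as Rayleigh quotient.\<close>

lemma lambda_min_rayleigh:
  assumes A: "A \<in> carrier_mat d d" and "d > 0" and sym: "\<forall>i<d. \<forall>j<d. A $$ (i, j) = A $$ (j, i)"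
  shows "lambda_min A * dot d v v \<le> bilin d (entries A) v v"
    and "\<exists>v. dot d v v = 1 \<and> bilin d (entries A) v v = lambda_min A"
proof -
  obtain g where g: "dot d g g = 1"
    and min: "\<And>v. bilin d (entries A) g g * dot d v v \<le> bilin d (entries A) v v"
    using rayleigh_minimizer[OF \<open>d > 0\<close>] by blast
  let ?\<mu> = "bilin d (entries A) g g"
  have eig: "(\<Sum>j<d. A $$ (i, j) * g j) = ?\<mu> * g i" if "i < d" for i
    by (rule rayleigh_minimizer_eigen[OF sym g min that])
  define w where "w = vec d g"
  have w: "w \<in> carrier_vec d" unfolding w_def by simp
  have "A *\<^sub>v w = ?\<mu> \<cdot>\<^sub>v w"
  proof (rule eq_vecI)
    fix i assume "i < dim_vec (?\<mu> \<cdot>\<^sub>v w)"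
    then have "i < d" unfolding w_def by simp
    then show "(A *\<^sub>v w) $ i = (?\<mu> \<cdot>\<^sub>v w) $ i"
      using mult_mat_vec_entry[OF A w] eig unfolding w_def by simp
  qed (use A in \<open>simp add: w_def\<close>)
  moreover have "w \<noteq> 0\<^sub>v d"
  proof
    assume "w = 0\<^sub>v d"
    then have "\<forall>i<d. g i = 0" unfolding w_def by (metis index_vec index_zero_vec(1))
    with g show False unfolding dot_def by simp
  qed
  ultimately have mem: "?\<mu> \<in> spectrum A"
    using A w unfolding spectrum_def eigenvalue_def eigenvector_def by auto
  have low: "?\<mu> \<le> l" if l: "l \<in> spectrum A" for l
  proof -
    obtain u where u: "u \<in> carrier_vec d" "u \<noteq> 0\<^sub>v d" "A *\<^sub>v u = l \<cdot>\<^sub>v u"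
      using l A unfolding spectrum_def eigenvalue_def eigenvector_def by auto
    have "(\<Sum>j<d. A $$ (i, j) * u $ j) = l * u $ i" if "i < d" for i
      using mult_mat_vec_entry[OF A u(1) that] u that by simp
    then have "bilin d (entries A) (($) u) (($) u) = l * dot d (($) u) (($) u)"
      by (subst bilin_eq_dot[where w="\<lambda>i. l * u $ i"]) (simp_all add: dot_scale_right)
    moreover have "dot d (($) u) (($) u) > 0"
    proof -
      obtain i where "i < d" "u $ i \<noteq> 0" using u by (metis eq_vecI carrier_vecD index_zero_vec)
      then show ?thesis using square_le_dot_self[of i d "($) u"]
        by (metis less_le_trans zero_less_power2)
    qed
    ultimately show ?thesis using min[of "($) u"] by simp
  qed
  have "lambda_min A = ?\<mu>"
    unfolding lambda_min_def by (rule Min_eqI) (use card_finite_spectrum[OF A] low mem in auto)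
  then show "lambda_min A * dot d v v \<le> bilin d (entries A) v v"
    and "\<exists>v. dot d v v = 1 \<and> bilin d (entries A) v v = lambda_min A"
    using min g by auto
qed

lemma lambda_min_less_iff:
  assumes "A \<in> carrier_mat d d" and "d > 0" and "\<forall>i<d. \<forall>j<d. A $$ (i, j) = A $$ (j, i)"
  shows "lambda_min A < c \<longleftrightarrow> (\<exists>v. bilin d (entries A) v v < c * dot d v v)"
proof
  assume "lambda_min A < c"
  then show "\<exists>v. bilin d (entries A) v v < c * dot d v v"
    using lambda_min_rayleigh(2)[OF assms] by (metis mult_1_right)
next
  assume "\<exists>v. bilin d (entries A) v v < c * dot d v v"
  then obtain v where "bilin d (entries A) v v < c * dot d v v" by blast
  with lambda_min_rayleigh(1)[OF assms, of v] have "lambda_min A * dot d v v < c * dot d v v" by linarith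
  then show "lambda_min A < c" using dot_self_nonneg[of d v] by (meson mult_right_mono not_le)
qed

text \<open>A strict inequality between continuous functions survives rational approximation. The countably
many \<open>w\<close> replace the uncountably many \<open>v\<close> when events about smallest eigenvalues are to be measurable.\<close>

lemma rational_quadratic_witness:
  assumes "bilin d A v v < c * dot d v v"
  shows "\<exists>w\<in>(\<Pi>\<^sub>E i\<in>{..<d}. \<rat>). bilin d A w w < c * dot d w w"
proof -
  \<comment> \<open>undefined from \<open>d\<close> on, so that the approximations lie in the extensional product \<open>\<Pi>\<^sub>E\<close>, a countable set\<close>
  define w where "w n i = (if i < d then real_of_int \<lfloor>v i * real (Suc n)\<rfloor> / real (Suc n) else undefined)" for n i
  have lim: "(\<lambda>n. w n i) \<longlonglongrightarrow> v i" if "i < d" for i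
  proof (rule tendsto_sandwich)
    have fl: "w n i \<le> v i \<and> v i - 1 / real (Suc n) \<le> w n i" for n
    proof -
      have "real_of_int \<lfloor>v i * real (Suc n)\<rfloor> / real (Suc n) \<le> v i * real (Suc n) / real (Suc n)"
        by (intro divide_right_mono) auto
      moreover have "(v i * real (Suc n) - 1) / real (Suc n) \<le> real_of_int \<lfloor>v i * real (Suc n)\<rfloor> / real (Suc n)"
        by (intro divide_right_mono) linarith+
      ultimately show ?thesis
        using that unfolding w_def by (simp add: diff_divide_distrib del: of_nat_Suc)
    qed
    then show "\<forall>\<^sub>F n in sequentially. v i - 1 / real (Suc n) \<le> w n i"
      and "\<forall>\<^sub>F n in sequentially. w n i \<le> v i"
      by auto
    show "(\<lambda>n. v i - 1 / real (Suc n)) \<longlonglongrightarrow> v i"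
      using tendsto_diff[OF tendsto_const LIMSEQ_inverse_real_of_nat, of "v i"]
      by (simp add: inverse_eq_divide)
  qed simp
  have "(\<lambda>n. bilin d A (w n) (w n)) \<longlonglongrightarrow> bilin d A v v"
    unfolding bilin_def by (intro tendsto_intros lim) auto
  moreover have "(\<lambda>n. c * dot d (w n) (w n)) \<longlonglongrightarrow> c * dot d v v"
    unfolding dot_def by (intro tendsto_intros lim) auto
  ultimately have "(\<lambda>n. c * dot d (w n) (w n) - bilin d A (w n) (w n)) \<longlonglongrightarrow> c * dot d v v - bilin d A v v"
    by (intro tendsto_diff)
  then have "\<forall>\<^sub>F n in sequentially. 0 < c * dot d (w n) (w n) - bilin d A (w n) (w n)"
    by (rule order_tendstoD(1)) (use assms in simp)
  then obtain n where "bilin d A (w n) (w n) < c * dot d (w n) (w n)"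
    unfolding eventually_sequentially by (meson diff_gt_0_iff_gt order_refl)
  moreover have "w n \<in> (\<Pi>\<^sub>E i\<in>{..<d}. \<rat>)"
    unfolding w_def by (auto simp: PiE_iff extensional_def)
  ultimately show ?thesis by blast
qed


section \<open>Moments of sample means\<close>

lemma abs_power_le_one_plus_fourth:
  fixes x :: real
  assumes "j \<le> 4"
  shows "\<bar>x ^ j\<bar> \<le> 1 + x ^ 4"
proof (cases "\<bar>x\<bar> \<le> 1")
  case True
  then have "\<bar>x\<bar> ^ j \<le> 1" by (intro power_le_one) auto
  moreover have "0 \<le> x ^ 4" by simp
  ultimately show ?thesis unfolding power_abs by linarith
next
  case False
  then have "\<bar>x\<bar> ^ j \<le> \<bar>x\<bar> ^ 4" by (intro power_increasing assms) auto
  also have "\<bar>x\<bar> ^ 4 = x ^ 4" by (rule power_even_abs) simp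
  finally show ?thesis unfolding power_abs by linarith
qed

lemma square_le_half_one_plus_fourth: "(x::real)\<^sup>2 \<le> (1 + x ^ 4) / 2"
proof -
  have "0 \<le> (1 - x\<^sup>2)\<^sup>2" by simp
  also have "(1 - x\<^sup>2)\<^sup>2 = 1 - 2 * x\<^sup>2 + x ^ 4" by (simp add: power2_diff flip: power_mult)
  finally show ?thesis by simp
qed

lemma (in finite_measure) integrable_power_of_fourth:
  fixes X :: "'a \<Rightarrow> real"
  assumes "X \<in> borel_measurable M" "integrable M (\<lambda>\<omega>. X \<omega> ^ 4)" "j \<le> 4"
  shows "integrable M (\<lambda>\<omega>. X \<omega> ^ j)"
proof (rule Bochner_Integration.integrable_bound)
  show "integrable M (\<lambda>\<omega>. 1 + X \<omega> ^ 4)" using assms by simp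
  show "AE \<omega> in M. norm (X \<omega> ^ j) \<le> norm (1 + X \<omega> ^ 4)"
    using abs_power_le_one_plus_fourth[OF assms(3)] by (intro AE_I2) (auto intro: order_trans)
qed (use assms in measurable)

lemma fourth_power_add_le: "((x::real) + y) ^ 4 \<le> 8 * (x ^ 4 + y ^ 4)"
proof -
  have sq: "(a + b)\<^sup>2 \<le> 2 * (a\<^sup>2 + b\<^sup>2)" for a b :: real
    using sum_squares_bound[of a b] by (simp add: power2_sum)
  have "(x + y) ^ 4 = ((x + y)\<^sup>2)\<^sup>2" by (simp flip: power_mult)
  also have "\<dots> \<le> (2 * (x\<^sup>2 + y\<^sup>2))\<^sup>2" by (intro power_mono sq) simp
  also have "\<dots> = 4 * (x\<^sup>2 + y\<^sup>2)\<^sup>2" by (simp only: power_mult_distrib) simp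
  also have "\<dots> \<le> 4 * (2 * ((x\<^sup>2)\<^sup>2 + (y\<^sup>2)\<^sup>2))" using sq[of "x\<^sup>2" "y\<^sup>2"] by simp
  finally show ?thesis by (simp flip: power_mult)
qed

lemma integrable_fourth_power_add:
  fixes f g :: "'a \<Rightarrow> real"
  assumes [measurable]: "f \<in> borel_measurable M" "g \<in> borel_measurable M"
    and "integrable M (\<lambda>\<omega>. f \<omega> ^ 4)" "integrable M (\<lambda>\<omega>. g \<omega> ^ 4)"
  shows "integrable M (\<lambda>\<omega>. (f \<omega> + g \<omega>) ^ 4)"
proof (rule Bochner_Integration.integrable_bound)
  show "integrable M (\<lambda>\<omega>. 8 * (f \<omega> ^ 4 + g \<omega> ^ 4))" using assms by simp
  show "AE \<omega> in M. norm ((f \<omega> + g \<omega>) ^ 4) \<le> norm (8 * (f \<omega> ^ 4 + g \<omega> ^ 4))"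
    using fourth_power_add_le by (intro AE_I2) (simp add: abs_mult)
qed measurable

text \<open>Adding an independent centred \<open>Y\<close> to the partial sum \<open>T\<close>, the mixed terms of odd degree in \<open>Y\<close> or \<open>T\<close> vanish, so
\<open>E (Y + T)\<^sup>4 = E Y\<^sup>4 + 6 E Y\<^sup>2 E T\<^sup>2 + E T\<^sup>4\<close>. The middle term grows linearly in the number of summands, hence
the fourth moment grows quadratically. The second moments are at most \<open>(1 + B) / 2\<close> because \<open>x\<^sup>2 \<le> (1 + x\<^sup>4) / 2\<close>.\<close>

lemma (in prob_space) indep_sum_moments:
  fixes X :: "'i \<Rightarrow> 'a \<Rightarrow> real"
  assumes "finite I" and "indep_vars (\<lambda>_. borel) X I"
    and "\<And>i. i \<in> I \<Longrightarrow> integrable M (\<lambda>\<omega>. X i \<omega> ^ 4)"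
    and "\<And>i. i \<in> I \<Longrightarrow> expectation (X i) = 0"
    and "\<And>i. i \<in> I \<Longrightarrow> expectation (\<lambda>\<omega>. X i \<omega> ^ 4) \<le> B"
  shows "integrable M (\<lambda>\<omega>. (\<Sum>i\<in>I. X i \<omega>) ^ 4) \<and> expectation (\<lambda>\<omega>. \<Sum>i\<in>I. X i \<omega>) = 0 \<and>
    expectation (\<lambda>\<omega>. (\<Sum>i\<in>I. X i \<omega>)\<^sup>2) = (\<Sum>i\<in>I. expectation (\<lambda>\<omega>. (X i \<omega>)\<^sup>2)) \<and>
    expectation (\<lambda>\<omega>. (\<Sum>i\<in>I. X i \<omega>) ^ 4) \<le> (real (card I))\<^sup>2 * (3 * ((1 + B) / 2)\<^sup>2 + B)"
  using assms
proof (induction I rule: finite_induct)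
  case empty
  then show ?case by simp
next
  case (insert i I)
  define T where "T \<omega> = (\<Sum>i\<in>I. X i \<omega>)" for \<omega>
  define Y where "Y = X i"
  define k where "k = real (card I)"
  define S where "S = (1 + B) / 2"
  have rvX [measurable]: "X j \<in> borel_measurable M" if "j \<in> insert i I" for j
    using insert.prems(1) that unfolding indep_vars_def by auto
  have [measurable]: "Y \<in> borel_measurable M" "T \<in> borel_measurable M"
    unfolding Y_def T_def using rvX by auto
  have IH: "integrable M (\<lambda>\<omega>. T \<omega> ^ 4)" "expectation T = 0"
    "expectation (\<lambda>\<omega>. (T \<omega>)\<^sup>2) = (\<Sum>i\<in>I. expectation (\<lambda>\<omega>. (X i \<omega>)\<^sup>2))"
    "expectation (\<lambda>\<omega>. T \<omega> ^ 4) \<le> k\<^sup>2 * (3 * S\<^sup>2 + B)"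
    using insert.IH indep_vars_subset[OF insert.prems(1), of I] insert.prems(2-4)
    unfolding T_def k_def S_def by auto
  have Y4: "integrable M (\<lambda>\<omega>. Y \<omega> ^ 4)" "expectation Y = 0" "expectation (\<lambda>\<omega>. Y \<omega> ^ 4) \<le> B"
    using insert.prems(2-4) unfolding Y_def by auto
  have ind: "indep_var borel Y borel T"
    unfolding Y_def T_def by (rule indep_vars_sum[OF insert.hyps insert.prems(1)])
  have iY: "integrable M (\<lambda>\<omega>. Y \<omega> ^ a)" if "a \<le> 4" for a
    by (rule integrable_power_of_fourth[OF _ Y4(1) that]) simp
  have iT: "integrable M (\<lambda>\<omega>. T \<omega> ^ a)" if "a \<le> 4" for a
    by (rule integrable_power_of_fourth[OF _ IH(1) that]) simp
  have indp: "indep_var borel (\<lambda>\<omega>. Y \<omega> ^ a) borel (\<lambda>\<omega>. T \<omega> ^ b)" for a b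
    using indep_var_compose[OF ind, of "\<lambda>x. x ^ a" borel "\<lambda>x. x ^ b" borel] by (simp add: comp_def)
  have iYT: "integrable M (\<lambda>\<omega>. Y \<omega> ^ a * T \<omega> ^ b)"
    and eYT: "expectation (\<lambda>\<omega>. Y \<omega> ^ a * T \<omega> ^ b) = expectation (\<lambda>\<omega>. Y \<omega> ^ a) * expectation (\<lambda>\<omega>. T \<omega> ^ b)"
    if "a \<le> 4" "b \<le> 4" for a b
    using indep_var_integrable[OF indp iY[OF that(1)] iT[OF that(2)]]
      indep_var_lebesgue_integral[OF indp iY[OF that(1)] iT[OF that(2)]] by auto
  have S0: "0 \<le> B" by (rule order_trans[OF Bochner_Integration.integral_nonneg Y4(3)]) simp
  have sq_le: "expectation (\<lambda>\<omega>. (X j \<omega>)\<^sup>2) \<le> S" if "j \<in> insert i I" for j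
  proof -
    have "integrable M (\<lambda>\<omega>. (X j \<omega>)\<^sup>2)"
      by (rule integrable_power_of_fourth[OF rvX[OF that] insert.prems(2)[OF that]]) simp
    then have "expectation (\<lambda>\<omega>. (X j \<omega>)\<^sup>2) \<le> expectation (\<lambda>\<omega>. (1 + X j \<omega> ^ 4) / 2)"
      using insert.prems(2)[OF that]
      by (intro integral_mono square_le_half_one_plus_fourth) auto
    also have "\<dots> = (1 + expectation (\<lambda>\<omega>. X j \<omega> ^ 4)) / 2"
      using insert.prems(2)[OF that] by (simp add: prob_space)
    finally show ?thesis unfolding S_def using insert.prems(4)[OF that] by simp
  qed
  have sumeq: "(\<Sum>j\<in>insert i I. X j \<omega>) = Y \<omega> + T \<omega>" for \<omega>
    using insert.hyps by (simp add: Y_def T_def)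
  have E1: "expectation (\<lambda>\<omega>. Y \<omega> + T \<omega>) = 0"
    using iY[of 1] iT[of 1] IH(2) Y4(2) by simp
  have "expectation (\<lambda>\<omega>. (Y \<omega> + T \<omega>)\<^sup>2) =
    expectation (\<lambda>\<omega>. Y \<omega> ^ 2 + 2 * (Y \<omega> ^ 1 * T \<omega> ^ 1) + T \<omega> ^ 2)"
    by (simp add: power2_sum algebra_simps)
  also have "\<dots> = expectation (\<lambda>\<omega>. (Y \<omega>)\<^sup>2) + expectation (\<lambda>\<omega>. (T \<omega>)\<^sup>2)"
    using iY[of 2] iT[of 2] iYT[of 1 1] eYT[of 1 1] IH(2) by simp
  finally have E2: "expectation (\<lambda>\<omega>. (Y \<omega> + T \<omega>)\<^sup>2) = expectation (\<lambda>\<omega>. (Y \<omega>)\<^sup>2) + expectation (\<lambda>\<omega>. (T \<omega>)\<^sup>2)" .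
  have "(\<lambda>\<omega>. (Y \<omega> + T \<omega>) ^ 4) = (\<lambda>\<omega>. Y \<omega> ^ 4 + 4 * (Y \<omega> ^ 3 * T \<omega> ^ 1) +
      6 * (Y \<omega> ^ 2 * T \<omega> ^ 2) + 4 * (Y \<omega> ^ 1 * T \<omega> ^ 3) + T \<omega> ^ 4)"
    by (rule ext) (simp add: power4_eq_xxxx power3_eq_cube power2_eq_square algebra_simps)
  moreover have "expectation (\<lambda>\<omega>. Y \<omega> ^ 4 + 4 * (Y \<omega> ^ 3 * T \<omega> ^ 1) +
      6 * (Y \<omega> ^ 2 * T \<omega> ^ 2) + 4 * (Y \<omega> ^ 1 * T \<omega> ^ 3) + T \<omega> ^ 4) =
     expectation (\<lambda>\<omega>. Y \<omega> ^ 4) + 6 * (expectation (\<lambda>\<omega>. (Y \<omega>)\<^sup>2) * expectation (\<lambda>\<omega>. (T \<omega>)\<^sup>2)) +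
     expectation (\<lambda>\<omega>. T \<omega> ^ 4)"
    using iY[of 4] iT[of 4] iYT[of 3 1] iYT[of 2 2] iYT[of 1 3] eYT[of 3 1] eYT[of 2 2] eYT[of 1 3]
      IH(2) Y4(2) by simp
  ultimately have E4: "expectation (\<lambda>\<omega>. (Y \<omega> + T \<omega>) ^ 4) =
     expectation (\<lambda>\<omega>. Y \<omega> ^ 4) + 6 * (expectation (\<lambda>\<omega>. (Y \<omega>)\<^sup>2) * expectation (\<lambda>\<omega>. (T \<omega>)\<^sup>2)) +
     expectation (\<lambda>\<omega>. T \<omega> ^ 4)" by simp
  have ET2: "expectation (\<lambda>\<omega>. (T \<omega>)\<^sup>2) \<le> k * S"
    unfolding IH(3) k_def using sum_bounded_above[of I "\<lambda>i. expectation (\<lambda>\<omega>. (X i \<omega>)\<^sup>2)" S] sq_le by simp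
  have "expectation (\<lambda>\<omega>. (Y \<omega>)\<^sup>2) * expectation (\<lambda>\<omega>. (T \<omega>)\<^sup>2) \<le> S * (k * S)"
    by (intro mult_mono ET2) (use sq_le S0 in \<open>auto simp: Y_def S_def k_def\<close>)
  with E4 IH(4) Y4(3) have "expectation (\<lambda>\<omega>. (Y \<omega> + T \<omega>) ^ 4) \<le> B + 6 * (S * (k * S)) + k\<^sup>2 * (3 * S\<^sup>2 + B)"
    by linarith
  also have "\<dots> \<le> (k + 1)\<^sup>2 * (3 * S\<^sup>2 + B)"
  proof -
    have "(k + 1)\<^sup>2 * (3 * S\<^sup>2 + B) - (B + 6 * (S * (k * S)) + k\<^sup>2 * (3 * S\<^sup>2 + B)) = 2 * (k * B) + 3 * S\<^sup>2"
      by (simp add: power2_eq_square algebra_simps)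
    moreover have "0 \<le> 2 * (k * B) + 3 * S\<^sup>2" using S0 unfolding k_def by simp
    ultimately show ?thesis by linarith
  qed
  finally have "expectation (\<lambda>\<omega>. (Y \<omega> + T \<omega>) ^ 4) \<le> (real (card (insert i I)))\<^sup>2 * (3 * S\<^sup>2 + B)"
    using insert.hyps unfolding k_def by (simp add: add.commute)
  moreover have "integrable M (\<lambda>\<omega>. (Y \<omega> + T \<omega>) ^ 4)"
    by (rule integrable_fourth_power_add[OF _ _ Y4(1) IH(1)]) auto
  ultimately show ?case
    unfolding sumeq using E1 E2 IH(3) insert.hyps by (simp add: S_def Y_def)
qed

lemma indep_vars_PiM_coordinates:
  assumes "prob_space N" "I \<noteq> {}"
  shows "prob_space.indep_vars (PiM I (\<lambda>_. N)) (\<lambda>_. N) (\<lambda>i \<omega>. \<omega> i) I"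
proof -
  interpret P: prob_space "PiM I (\<lambda>_. N)" by (intro prob_space_PiM assms)
  have "distr (PiM I (\<lambda>_. N)) (PiM I (\<lambda>_. N)) (\<lambda>x. \<lambda>i\<in>I. x i) = distr (PiM I (\<lambda>_. N)) (PiM I (\<lambda>_. N)) (\<lambda>x. x)"
    by (intro distr_cong refl) (auto simp: space_PiM PiE_def extensional_restrict)
  also have "\<dots> = PiM I (\<lambda>_. N)" by (rule distr_id)
  also have "\<dots> = (\<Pi>\<^sub>M i\<in>I. distr (PiM I (\<lambda>_. N)) N (\<lambda>\<omega>. \<omega> i))"
    by (intro PiM_cong refl distr_PiM_component[symmetric] assms)
  finally show ?thesis
    by (subst P.indep_vars_iff_distr_eq_PiM'[OF assms(2)]) auto
qed

lemma integral_PiM_coordinate: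
  fixes f :: "'a \<Rightarrow> real"
  assumes "prob_space N" "i \<in> I" and [measurable]: "f \<in> borel_measurable N"
  shows "(LINT \<omega>|PiM I (\<lambda>_. N). f (\<omega> i)) = (LINT z|N. f z)"
    and "integrable (PiM I (\<lambda>_. N)) (\<lambda>\<omega>. f (\<omega> i)) \<longleftrightarrow> integrable N f"
proof -
  have d: "distr (PiM I (\<lambda>_. N)) N (\<lambda>\<omega>. \<omega> i) = N" by (rule distr_PiM_component) (use assms in auto)
  have m: "(\<lambda>\<omega>. \<omega> i) \<in> measurable (PiM I (\<lambda>_. N)) N" using assms(2) by measurable
  show "(LINT \<omega>|PiM I (\<lambda>_. N). f (\<omega> i)) = (LINT z|N. f z)"
    using integral_distr[OF m, of f] unfolding d by simp
  show "integrable (PiM I (\<lambda>_. N)) (\<lambda>\<omega>. f (\<omega> i)) \<longleftrightarrow> integrable N f"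
    using integrable_distr_eq[OF m, of f] unfolding d by simp
qed

definition sample_mean :: "nat \<Rightarrow> ('a \<Rightarrow> real) \<Rightarrow> (nat \<Rightarrow> 'a) \<Rightarrow> real" where
  "sample_mean n f \<omega> = (\<Sum>i<n. f (\<omega> i)) / real n"

lemma sample_mean_moments:
  fixes f :: "'a \<Rightarrow> real"
  assumes N: "prob_space N" and n: "n \<ge> 1"
    and [measurable]: "f \<in> borel_measurable N"
    and f4: "integrable N (\<lambda>z. f z ^ 4)" and mean: "(LINT z|N. f z) = 0"
    and B: "(LINT z|N. f z ^ 4) \<le> B"
  shows "integrable (PiM {..<n} (\<lambda>_. N)) (\<lambda>\<omega>. sample_mean n f \<omega> ^ 4)"
    and "(LINT \<omega>|PiM {..<n} (\<lambda>_. N). sample_mean n f \<omega> ^ 4) \<le> (3 * ((1 + B) / 2)\<^sup>2 + B) / (real n)\<^sup>2"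
    and "(LINT \<omega>|PiM {..<n} (\<lambda>_. N). (sample_mean n f \<omega>)\<^sup>2) = (LINT z|N. (f z)\<^sup>2) / real n"
proof -
  let ?P = "PiM {..<n} (\<lambda>_. N)"
  interpret P: prob_space ?P by (intro prob_space_PiM N)
  have ne: "{..<n} \<noteq> {}" using n by (auto simp: lessThan_empty_iff)
  have ind: "P.indep_vars (\<lambda>_. borel) (\<lambda>i \<omega>. f (\<omega> i)) {..<n}"
    by (rule P.indep_vars_compose2[OF indep_vars_PiM_coordinates[OF N ne]]) simp
  have m: "f \<in> borel_measurable N" "(\<lambda>z. f z ^ 4) \<in> borel_measurable N" "(\<lambda>z. (f z)\<^sup>2) \<in> borel_measurable N" by auto
  note c1 = integral_PiM_coordinate[OF N _ m(1)] and c4 = integral_PiM_coordinate[OF N _ m(2)]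
    and c2 = integral_PiM_coordinate[OF N _ m(3)]
  have mom: "integrable ?P (\<lambda>\<omega>. (\<Sum>i<n. f (\<omega> i)) ^ 4)"
    "P.expectation (\<lambda>\<omega>. (\<Sum>i<n. f (\<omega> i))\<^sup>2) = (\<Sum>i<n. P.expectation (\<lambda>\<omega>. (f (\<omega> i))\<^sup>2))"
    "P.expectation (\<lambda>\<omega>. (\<Sum>i<n. f (\<omega> i)) ^ 4) \<le> (real n)\<^sup>2 * (3 * ((1 + B) / 2)\<^sup>2 + B)"
    using P.indep_sum_moments[OF _ ind, of B] f4 mean B by (auto simp: c1 c4)
  have n0: "real n > 0" using n by simp
  show "integrable ?P (\<lambda>\<omega>. sample_mean n f \<omega> ^ 4)"
    unfolding sample_mean_def power_divide using mom(1) by simp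
  have "P.expectation (\<lambda>\<omega>. sample_mean n f \<omega> ^ 4) = P.expectation (\<lambda>\<omega>. (\<Sum>i<n. f (\<omega> i)) ^ 4) / real n ^ 4"
    unfolding sample_mean_def power_divide by simp
  also have "\<dots> \<le> (real n)\<^sup>2 * (3 * ((1 + B) / 2)\<^sup>2 + B) / real n ^ 4"
    by (rule divide_right_mono[OF mom(3)]) simp
  also have "\<dots> = (3 * ((1 + B) / 2)\<^sup>2 + B) / (real n)\<^sup>2"
    using n0 by (simp add: power4_eq_xxxx power2_eq_square)
  finally show "P.expectation (\<lambda>\<omega>. sample_mean n f \<omega> ^ 4) \<le> (3 * ((1 + B) / 2)\<^sup>2 + B) / (real n)\<^sup>2" .
  have "P.expectation (\<lambda>\<omega>. (sample_mean n f \<omega>)\<^sup>2) = (\<Sum>i<n. P.expectation (\<lambda>\<omega>. (f (\<omega> i))\<^sup>2)) / (real n)\<^sup>2"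
    unfolding sample_mean_def power_divide using mom(2) by simp
  also have "\<dots> = real n * (LINT z|N. (f z)\<^sup>2) / (real n)\<^sup>2" by (simp add: c2)
  finally show "P.expectation (\<lambda>\<omega>. (sample_mean n f \<omega>)\<^sup>2) = (LINT z|N. (f z)\<^sup>2) / real n"
    by (simp add: power2_eq_square)
qed

text \<open>Follows from the variance of a sample mean, applied to \<open>f\<close>, \<open>g\<close> and \<open>f + g\<close>, by polarization.\<close>

lemma sample_mean_covariance:
  fixes f g :: "'a \<Rightarrow> real"
  assumes N: "prob_space N" and n: "n \<ge> 1"
    and [measurable]: "f \<in> borel_measurable N" "g \<in> borel_measurable N"
    and f4: "integrable N (\<lambda>z. f z ^ 4)" "integrable N (\<lambda>z. g z ^ 4)"
    and mean: "(LINT z|N. f z) = 0" "(LINT z|N. g z) = 0"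
  shows "integrable (PiM {..<n} (\<lambda>_. N)) (\<lambda>\<omega>. sample_mean n f \<omega> * sample_mean n g \<omega>)"
    and "(LINT \<omega>|PiM {..<n} (\<lambda>_. N). sample_mean n f \<omega> * sample_mean n g \<omega>) = (LINT z|N. f z * g z) / real n"
proof -
  let ?P = "PiM {..<n} (\<lambda>_. N)"
  interpret N: prob_space N by fact
  interpret P: prob_space ?P by (intro prob_space_PiM N)
  let ?h = "\<lambda>z. f z + g z"
  have h4: "integrable N (\<lambda>z. ?h z ^ 4)" by (intro integrable_fourth_power_add f4) auto
  have i1: "integrable N f" "integrable N g"
    using N.integrable_power_of_fourth[OF _ f4(1), of 1] N.integrable_power_of_fourth[OF _ f4(2), of 1] by auto
  have hm: "(LINT z|N. ?h z) = 0" using i1 mean by simp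
  have [measurable]: "sample_mean n u \<in> borel_measurable ?P" if [measurable]: "u \<in> borel_measurable N" for u
    unfolding sample_mean_def by measurable
  have pol: "x * y = ((x + y)\<^sup>2 - x\<^sup>2 - y\<^sup>2) / 2" for x y :: real by (simp add: power2_sum)
  have add: "sample_mean n f \<omega> + sample_mean n g \<omega> = sample_mean n ?h \<omega>" for \<omega>
    unfolding sample_mean_def by (simp add: sum.distrib add_divide_distrib)
  have sq: "integrable ?P (\<lambda>\<omega>. (sample_mean n u \<omega>)\<^sup>2)"
    if "u \<in> borel_measurable N" "integrable N (\<lambda>z. u z ^ 4)" "(LINT z|N. u z) = 0" for u
    using P.integrable_power_of_fourth[OF _ sample_mean_moments(1)[OF N n that order_refl], of 2] that by simp
  have sqN: "integrable N (\<lambda>z. (u z)\<^sup>2)"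
    if "u \<in> borel_measurable N" "integrable N (\<lambda>z. u z ^ 4)" for u :: "'a \<Rightarrow> real"
    using N.integrable_power_of_fourth[OF that, of 2] by simp
  note v = sample_mean_moments(3)[OF N n _ _ _ order_refl]
  show "integrable ?P (\<lambda>\<omega>. sample_mean n f \<omega> * sample_mean n g \<omega>)"
    unfolding pol add using f4 h4 hm mean by (intro integrable_divide Bochner_Integration.integrable_diff sq) auto
  have "P.expectation (\<lambda>\<omega>. sample_mean n f \<omega> * sample_mean n g \<omega>) =
    (P.expectation (\<lambda>\<omega>. (sample_mean n ?h \<omega>)\<^sup>2) - P.expectation (\<lambda>\<omega>. (sample_mean n f \<omega>)\<^sup>2)
      - P.expectation (\<lambda>\<omega>. (sample_mean n g \<omega>)\<^sup>2)) / 2"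
    unfolding pol add using f4 h4 hm mean sq by simp
  also have "\<dots> = ((LINT z|N. (?h z)\<^sup>2) - (LINT z|N. (f z)\<^sup>2) - (LINT z|N. (g z)\<^sup>2)) / 2 / real n"
    using v[of f] v[of g] v[of ?h] f4 h4 hm mean by (simp add: diff_divide_distrib)
  also have "\<dots> = (LINT z|N. f z * g z) / real n"
    unfolding pol using sqN[of f] sqN[of g] sqN[of ?h] f4 h4 by simp
  finally show "P.expectation (\<lambda>\<omega>. sample_mean n f \<omega> * sample_mean n g \<omega>) = (LINT z|N. f z * g z) / real n" .
qed


section \<open>The best polynomial approximation\<close>

lemma id_measurable_Leb [measurable]: "(\<lambda>x. x) \<in> borel_measurable Leb"
  using id_borel_measurable_lebesgue_on[of "{-1..1}"] by (simp add: id_def)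

lemma finite_measure_Leb: "finite_measure Leb"
  using finite_measure_lebesgue_on[OF lmeasurable_cbox[of "-1" "1::real"]] by simp

lemma integrable_Leb_power_mult:
  assumes "integrable Leb f"
  shows "integrable Leb (\<lambda>x. x ^ j * f x)"
proof (rule Bochner_Integration.integrable_bound[OF assms])
  have "f \<in> borel_measurable Leb" using assms by auto
  then show "(\<lambda>x. x ^ j * f x) \<in> borel_measurable Leb" by measurable
  show "AE x in Leb. norm (x ^ j * f x) \<le> norm (f x)"
  proof (rule AE_I2)
    fix x :: real assume "x \<in> space Leb"
    then have "\<bar>x\<bar> ^ j \<le> 1" by (intro power_le_one) auto
    then show "norm (x ^ j * f x) \<le> norm (f x)"
      by (simp add: abs_mult power_abs mult_left_le_one_le)
  qed
qed

lemma integrable_Leb_power: "integrable Leb (\<lambda>x. x ^ j)"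
  using integrable_Leb_power_mult[of "\<lambda>_. 1" j] finite_measure.integrable_const[OF finite_measure_Leb] by simp

lemma powers_entry: "j < K + 1 \<Longrightarrow> powers K x $ j = x ^ j"
  unfolding powers_def by simp

lemma Q_mat_carrier: "Q_mat K \<in> carrier_mat (K + 1) (K + 1)"
  unfolding Q_mat_def by simp

lemma Q_mat_entry:
  assumes "i < K + 1" "j < K + 1"
  shows "Q_mat K $$ (i, j) = (LINT x|Leb. 1/2 * x ^ (i + j))"
  using assms unfolding Q_mat_def by (simp add: powers_entry power_add)

lemma powers_scalar_prod:
  assumes "v \<in> carrier_vec (K + 1)"
  shows "powers K x \<bullet> v = (\<Sum>j<K + 1. x ^ j * v $ j)"
  using assms unfolding scalar_prod_def
  by (auto simp: powers_entry atLeast0LessThan intro!: sum.cong)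

lemma Q_mat_sym: "\<forall>i<K + 1. \<forall>j<K + 1. Q_mat K $$ (i, j) = Q_mat K $$ (j, i)"
  by (simp add: Q_mat_entry add.commute)

text \<open>\<open>Q\<close> is the Gram matrix of the monomials in \<open>L\<^sup>2\<close> of the uniform distribution. Hence it is positive definite, as a
nonzero polynomial has only finitely many roots.\<close>

lemma bilin_Q_mat:
  "bilin (K + 1) (entries (Q_mat K)) u v = (LINT x|Leb. 1/2 * ((\<Sum>i<K + 1. x ^ i * u i) * (\<Sum>j<K + 1. x ^ j * v j)))"
proof -
  have i: "integrable Leb (\<lambda>x. u i * (1/2 * x ^ (i + j)) * v j)" for i j
    using integrable_Leb_power[of "i + j"] by simp
  have "bilin (K + 1) (entries (Q_mat K)) u v = (\<Sum>i<K + 1. \<Sum>j<K + 1. (LINT x|Leb. u i * (1/2 * x ^ (i + j)) * v j))"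
    unfolding bilin_def by (intro sum.cong refl) (simp only: Q_mat_entry lessThan_iff, simp)
  also have "\<dots> = (LINT x|Leb. (\<Sum>i<K + 1. \<Sum>j<K + 1. u i * (1/2 * x ^ (i + j)) * v j))"
    using i by (simp only: Bochner_Integration.integral_sum Bochner_Integration.integrable_sum)
  also have "\<dots> = (LINT x|Leb. 1/2 * ((\<Sum>i<K + 1. x ^ i * u i) * (\<Sum>j<K + 1. x ^ j * v j)))"
    by (intro Bochner_Integration.integral_cong refl)
       (simp only: sum_product, simp only: sum_distrib_left, simp only: power_add mult_ac)
  finally show ?thesis .
qed

lemma bilin_Q_mat_pos:
  assumes v: "dot (K + 1) v v = 1"
  shows "0 < bilin (K + 1) (entries (Q_mat K)) v v"
proof -
  define P where "P x = (\<Sum>j<K + 1. x ^ j * v j)" for x :: real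
  have eq: "bilin (K + 1) (entries (Q_mat K)) v v = (LINT x|Leb. 1/2 * (P x)\<^sup>2)"
    unfolding bilin_Q_mat P_def power2_eq_square ..
  obtain k where k: "k < K + 1" "v k \<noteq> 0"
  proof (rule ccontr)
    assume "\<not> thesis"
    with that have "\<forall>k<K + 1. v k = 0" by blast
    then have "dot (K + 1) v v = 0" unfolding dot_def by simp
    with v show False by simp
  qed
  have "finite {x. (\<Sum>j\<le>K. v j * x ^ j) = 0}"
    by (rule polyfun_finite_roots[THEN iffD2]) (use k in \<open>auto simp: less_Suc_eq_le\<close>)
  then have fin: "finite {x. P x = 0}"
    unfolding P_def by (simp add: mult.commute lessThan_Suc_atMost)
  have int: "integrable Leb (\<lambda>x. 1/2 * (P x)\<^sup>2)"
  proof -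
    have "1/2 * (P x)\<^sup>2 = (\<Sum>i<K + 1. \<Sum>j<K + 1. (1/2 * v i * v j) * x ^ (i + j))" for x
      unfolding P_def power2_eq_square by (simp only: sum_product sum_distrib_left power_add mult_ac)
    then show ?thesis
      by (simp only:) (intro Bochner_Integration.integrable_sum integrable_mult_right integrable_Leb_power)
  qed
  have "(LINT x|Leb. 1/2 * (P x)\<^sup>2) \<noteq> 0"
  proof
    assume "(LINT x|Leb. 1/2 * (P x)\<^sup>2) = 0"
    then have "AE x in Leb. 1/2 * (P x)\<^sup>2 = 0"
      using integral_nonneg_eq_0_iff_AE[OF int] by simp
    then have "AE x in lebesgue. x \<in> {-1..1} \<longrightarrow> P x = 0"
      by (simp add: AE_restrict_space_iff)
    moreover have "AE x in lebesgue. x \<notin> {x. P x = 0}"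
      by (intro AE_not_in) (use fin negligible_finite negligible_iff_null_sets in blast)
    ultimately have "AE x in lebesgue. x \<notin> {-1..1 :: real}"
      by eventually_elim auto
    then have "{-1..1 :: real} \<in> null_sets lebesgue"
      by (simp add: AE_iff_null_sets)
    then have "emeasure lebesgue {-1..1 :: real} = 0" by auto
    then show False by simp
  qed
  moreover have "0 \<le> (LINT x|Leb. 1/2 * (P x)\<^sup>2)" by (rule Bochner_Integration.integral_nonneg) simp
  ultimately show ?thesis unfolding eq by linarith
qed

lemma lambda_min_Q_mat_pos: "0 < lambda_min (Q_mat K)"
proof -
  obtain v where "dot (K + 1) v v = 1" "bilin (K + 1) (entries (Q_mat K)) v v = lambda_min (Q_mat K)"
    using lambda_min_rayleigh(2)[OF Q_mat_carrier _ Q_mat_sym, of K] by auto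
  with bilin_Q_mat_pos show ?thesis by metis
qed

lemma bilin_Q_mat_coercive:
  "lambda_min (Q_mat K) * dot (K + 1) v v \<le> bilin (K + 1) (entries (Q_mat K)) v v"
  using lambda_min_rayleigh(1)[OF Q_mat_carrier _ Q_mat_sym] by simp

text \<open>A coercive matrix has trivial kernel, so \<open>mat_inverse\<close> does not fail on it and \<open>inv_mat\<close> is a genuine inverse.\<close>

lemma inv_mat_coercive:
  assumes A: "A \<in> carrier_mat d d" and c: "c > 0"
    and coer: "\<And>v. c * dot d v v \<le> bilin d (entries A) v v"
  shows "inv_mat A \<in> carrier_mat d d" "A * inv_mat A = 1\<^sub>m d" "inv_mat A * A = 1\<^sub>m d"
    and "det A \<noteq> 0"
proof -
  show det: "det A \<noteq> 0"
  proof
    assume "det A = 0"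
    then obtain v where v: "v \<in> carrier_vec d" "v \<noteq> 0\<^sub>v d" "A *\<^sub>v v = 0\<^sub>v d"
      using det_0_iff_vec_prod_zero[OF A] by auto
    have "\<forall>i<d. (\<Sum>j<d. A $$ (i, j) * v $ j) = 0"
      using mult_mat_vec_entry[OF A v(1)] v(3) by simp
    then have "bilin d (entries A) (($) v) (($) v) = 0"
      using bilin_eq_dot[of d "entries A" "($) v" "\<lambda>_. 0" "($) v"] by (simp add: dot_def)
    with coer[of "($) v"] c have "dot d (($) v) (($) v) \<le> 0"
      by (simp add: mult_le_0_iff)
    then have "\<forall>i<d. v $ i = 0"
      using square_le_dot_self[of _ d "($) v"] by (metis order_trans power2_less_eq_zero_iff)
    with v show False by (metis eq_vecI carrier_vecD index_zero_vec)
  qed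
  then have "mat_inverse A \<noteq> None"
    using mat_inverse(1)[OF A, where b="()"] det_non_zero_imp_unit[OF A, where b="()"] by blast
  then obtain B where "mat_inverse A = Some B" by blast
  with mat_inverse(2)[OF A this]
  show "inv_mat A \<in> carrier_mat d d" "A * inv_mat A = 1\<^sub>m d" "inv_mat A * A = 1\<^sub>m d" by auto
qed

lemmas inv_Q_mat = inv_mat_coercive[OF Q_mat_carrier lambda_min_Q_mat_pos bilin_Q_mat_coercive]

lemma beta_carrier: "beta K m \<in> carrier_vec (K + 1)"
  unfolding beta_def using inv_Q_mat(1) by (intro mult_mat_vec_carrier) auto

lemma Q_mat_beta:
  assumes "j < K + 1"
  shows "(\<Sum>k<K + 1. Q_mat K $$ (j, k) * beta K m $ k) = (LINT x|Leb. 1/2 * (x ^ j * m x))"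
proof -
  let ?b = "vec (K + 1) (\<lambda>j. LINT x|Leb. 1/2 * (powers K x $ j * m x))"
  have "Q_mat K *\<^sub>v beta K m = (Q_mat K * inv_mat (Q_mat K)) *\<^sub>v ?b"
    unfolding beta_def
    by (rule assoc_mult_mat_vec[OF Q_mat_carrier inv_Q_mat(1), symmetric]) simp
  also have "\<dots> = ?b" unfolding inv_Q_mat(2) by simp
  finally have "(Q_mat K *\<^sub>v beta K m) $ j = ?b $ j" by simp
  then show ?thesis
    unfolding mult_mat_vec_entry[OF Q_mat_carrier beta_carrier assms] using assms by (simp add: powers_entry)
qed

lemma ell_eq: "ell K m x = (\<Sum>j<K + 1. x ^ j * beta K m $ j)"
  unfolding ell_def by (rule powers_scalar_prod[OF beta_carrier])

lemma resid_eq: "resid K m z = m (fst z) + snd z - ell K m (fst z)"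
  unfolding resid_def response_def ell_def by (simp add: case_prod_unfold)

lemma ell_measurable [measurable]: "ell K m \<in> borel_measurable Leb"
  unfolding ell_eq[abs_def] by measurable

lemma resid_measurable [measurable]:
  assumes [measurable]: "m \<in> borel_measurable Leb"
  shows "resid K m \<in> borel_measurable (Leb \<Otimes>\<^sub>M borel)"
  unfolding resid_eq[abs_def] by measurable

lemma integrable_ell: "integrable Leb (ell K m)"
  unfolding ell_eq[abs_def] using integrable_Leb_power by (intro Bochner_Integration.integrable_sum) simp

section \<open>Integration against the law of covariate and noise\<close>

lemma prob_kernel:
  assumes "\<kappa> \<in> Leb \<rightarrow>\<^sub>M prob_algebra borel" "x \<in> {-1..1}"
  shows "prob_space (\<kappa> x)" "sets (\<kappa> x) = sets borel"
  using measurable_space[OF assms(1), of x] assms(2) by (auto simp: space_prob_algebra)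

lemma kernel_slice_measurable:
  assumes "\<kappa> \<in> Leb \<rightarrow>\<^sub>M prob_algebra borel" "f \<in> Leb \<Otimes>\<^sub>M borel \<rightarrow>\<^sub>M N" "x \<in> {-1..1}"
  shows "(\<lambda>e. f (x, e)) \<in> \<kappa> x \<rightarrow>\<^sub>M N"
proof -
  have "(\<lambda>e. f (x, e)) \<in> borel \<rightarrow>\<^sub>M N"
    by (rule measurable_Pair2[OF assms(2)]) (use assms(3) in simp)
  then show ?thesis
    using prob_kernel(2)[OF assms(1,3)] by (simp cong: measurable_cong_sets)
qed

lemma pair_kernel_measurable:
  assumes "\<kappa> \<in> Leb \<rightarrow>\<^sub>M prob_algebra borel"
  shows "(\<lambda>x. \<kappa> x \<bind> (\<lambda>e. return (Leb \<Otimes>\<^sub>M borel) (x, e))) \<in> Leb \<rightarrow>\<^sub>M prob_algebra (Leb \<Otimes>\<^sub>M borel)"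
  using measurable_bind_prob_space2[OF assms, of "\<lambda>x e. return (Leb \<Otimes>\<^sub>M borel) (x, e)" "Leb \<Otimes>\<^sub>M borel"]
    measurable_return_prob_space[of "Leb \<Otimes>\<^sub>M (borel :: real measure)"]
  by simp

lemma sets_pair_law:
  assumes "\<kappa> \<in> Leb \<rightarrow>\<^sub>M prob_algebra borel"
  shows "sets (pair_law p \<kappa>) = sets (Leb \<Otimes>\<^sub>M borel)"
  unfolding pair_law_def
  by (rule sets_bind_measurable)
     (use measurable_prob_algebraD[OF pair_kernel_measurable[OF assms]] in \<open>auto simp: measurable_def\<close>)

lemma nn_integral_pair_law:
  assumes \<kappa>: "\<kappa> \<in> Leb \<rightarrow>\<^sub>M prob_algebra borel" and p[measurable]: "p \<in> borel_measurable Leb"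
    and f[measurable]: "f \<in> borel_measurable (Leb \<Otimes>\<^sub>M borel)"
  shows "(\<integral>\<^sup>+z. f z \<partial>pair_law p \<kappa>) = (\<integral>\<^sup>+x. ennreal (p x) * (\<integral>\<^sup>+e. f (x, e) \<partial>\<kappa> x) \<partial>Leb)"
proof -
  let ?R = "Leb \<Otimes>\<^sub>M (borel :: real measure)"
  let ?k = "\<lambda>x. \<kappa> x \<bind> (\<lambda>e. return ?R (x, e))"
  have k: "?k \<in> Leb \<rightarrow>\<^sub>M subprob_algebra ?R"
    by (rule measurable_prob_algebraD[OF pair_kernel_measurable[OF \<kappa>]])
  then have k': "?k \<in> density Leb p \<rightarrow>\<^sub>M subprob_algebra ?R" by (simp add: measurable_def)
  have meas: "(\<lambda>x. \<integral>\<^sup>+z. f z \<partial>?k x) \<in> borel_measurable Leb"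
    by (rule measurable_compose[OF k nn_integral_measurable_subprob_algebra[OF f]])
  have inner: "(\<integral>\<^sup>+z. f z \<partial>?k x) = (\<integral>\<^sup>+e. f (x, e) \<partial>\<kappa> x)" if x: "x \<in> {-1..1}" for x
  proof -
    have "(\<lambda>e. return ?R (x, e)) \<in> borel \<rightarrow>\<^sub>M subprob_algebra ?R"
      by (rule measurable_Pair2[OF return_measurable]) (use x in simp)
    then have "(\<lambda>e. return ?R (x, e)) \<in> \<kappa> x \<rightarrow>\<^sub>M subprob_algebra ?R"
      using prob_kernel(2)[OF \<kappa> x] by (simp cong: measurable_cong_sets)
    then have "(\<integral>\<^sup>+z. f z \<partial>?k x) = (\<integral>\<^sup>+e. (\<integral>\<^sup>+z. f z \<partial>return ?R (x, e)) \<partial>\<kappa> x)"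
      by (rule nn_integral_bind[OF f])
    also have "\<dots> = (\<integral>\<^sup>+e. f (x, e) \<partial>\<kappa> x)"
      using x by (intro nn_integral_cong nn_integral_return f) (simp add: space_pair_measure)
    finally show ?thesis .
  qed
  have "(\<integral>\<^sup>+z. f z \<partial>pair_law p \<kappa>) = (\<integral>\<^sup>+x. (\<integral>\<^sup>+z. f z \<partial>?k x) \<partial>density Leb p)"
    unfolding pair_law_def by (rule nn_integral_bind[OF f k'])
  also have "\<dots> = (\<integral>\<^sup>+x. ennreal (p x) * (\<integral>\<^sup>+z. f z \<partial>?k x) \<partial>Leb)"
    by (rule nn_integral_density) (use meas in auto)
  also have "\<dots> = (\<integral>\<^sup>+x. ennreal (p x) * (\<integral>\<^sup>+e. f (x, e) \<partial>\<kappa> x) \<partial>Leb)"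
    by (intro nn_integral_cong) (simp add: inner)
  finally show ?thesis .
qed

lemma inner_nn_integral_measurable:
  assumes \<kappa>: "\<kappa> \<in> Leb \<rightarrow>\<^sub>M prob_algebra borel" 
    and f[measurable]: "f \<in> borel_measurable (Leb \<Otimes>\<^sub>M borel)"
  shows "(\<lambda>x. \<integral>\<^sup>+e. f (x, e) \<partial>\<kappa> x) \<in> borel_measurable Leb"
  by (rule nn_integral_measurable_subprob_algebra2[OF _ measurable_prob_algebraD[OF \<kappa>]])
     (simp add: case_prod_unfold)

text \<open>Disintegration for integrable real functions, reduced to the nonnegative case through the positive
and negative parts: \<open>F s\<close> is the conditional expectation of the part of \<open>f\<close> of sign \<open>s\<close>. Measurability of the
inner Bochner integral is part of the claim, since it cannot be read off from its definition.\<close>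

lemma integral_pair_law:
  fixes f :: "real \<times> real \<Rightarrow> real"
  assumes \<kappa>: "\<kappa> \<in> Leb \<rightarrow>\<^sub>M prob_algebra borel" and p[measurable]: "p \<in> borel_measurable Leb"
    and pos: "\<And>x. x \<in> {-1..1} \<Longrightarrow> 0 < p x"
    and int: "integrable (pair_law p \<kappa>) f"
  shows "(\<lambda>x. p x * (LINT e|\<kappa> x. f (x, e))) \<in> borel_measurable Leb"
    and "(LINT z|pair_law p \<kappa>. f z) = (LINT x|Leb. p x * (LINT e|\<kappa> x. f (x, e)))"
proof -
  have [measurable_cong]: "sets (pair_law p \<kappa>) = sets (Leb \<Otimes>\<^sub>M borel)" by (rule sets_pair_law[OF \<kappa>])
  have f[measurable]: "f \<in> borel_measurable (Leb \<Otimes>\<^sub>M borel)"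
    using borel_measurable_integrable[OF int] by simp
  define F where "F s x = (\<integral>\<^sup>+e. ennreal (s * f (x, e)) \<partial>\<kappa> x)" for s x :: real
  have Fm[measurable]: "F s \<in> borel_measurable Leb" for s
    unfolding F_def by (rule inner_nn_integral_measurable[OF \<kappa>, of "\<lambda>z. ennreal (s * f z)"]) simp
  have nn: "(\<integral>\<^sup>+z. ennreal (s * f z) \<partial>pair_law p \<kappa>) = (\<integral>\<^sup>+x. ennreal (p x) * F s x \<partial>Leb)" for s
    unfolding F_def by (rule nn_integral_pair_law[OF \<kappa> p, of "\<lambda>z. ennreal (s * f z)"]) simp
  have fin: "(\<integral>\<^sup>+x. ennreal (p x) * F s x \<partial>Leb) < \<infinity>" if "s = 1 \<or> s = -1" for s
  proof -
    have "(\<integral>\<^sup>+z. ennreal (s * f z) \<partial>pair_law p \<kappa>) < \<infinity>"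
      using int that unfolding real_integrable_def by (auto simp: top.not_eq_extremum)
    then show ?thesis unfolding nn .
  qed
  define G where "G s x = p x * enn2real (F s x)" for s x
  have Gm[measurable]: "G s \<in> borel_measurable Leb" for s unfolding G_def by measurable
  have Ffin: "AE x in Leb. F s x < \<infinity>" if "s = 1 \<or> s = -1" for s
  proof -
    have "AE x in Leb. ennreal (p x) * F s x \<noteq> \<infinity>"
      by (rule nn_integral_PInf_AE) (use fin[OF that] in auto)
    then show ?thesis
    proof (rule AE_mp, intro AE_I2 impI)
      fix x assume "x \<in> space Leb" and *: "ennreal (p x) * F s x \<noteq> \<infinity>"
      then have "ennreal (p x) \<noteq> 0" using pos[of x] by (simp add: ennreal_eq_0_iff)
      with * show "F s x < \<infinity>" by (auto simp: ennreal_mult_eq_top_iff less_top)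
    qed
  qed
  have G_nonneg: "0 \<le> G s x" if "x \<in> {-1..1}" for s x
    unfolding G_def using pos[OF that] by simp
  have GF: "AE x in Leb. ennreal (p x) * F s x = ennreal (G s x)" if "s = 1 \<or> s = -1" for s
    using Ffin[OF that]
    by (rule AE_mp) (intro AE_I2, use pos in \<open>auto simp: G_def ennreal_mult less_imp_le\<close>)
  have Gnn: "(\<integral>\<^sup>+x. ennreal (G s x) \<partial>Leb) = (\<integral>\<^sup>+z. ennreal (s * f z) \<partial>pair_law p \<kappa>)" if "s = 1 \<or> s = -1" for s
    unfolding nn using GF[OF that] by (intro nn_integral_cong_AE) auto
  have Gint: "integrable Leb (G s)" if "s = 1 \<or> s = -1" for s
    using Gnn[OF that] fin[OF that] nn
    by (intro integrableI_nonneg) (auto intro!: AE_I2 G_nonneg)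
  have GL: "(LINT x|Leb. G s x) = enn2real (\<integral>\<^sup>+z. ennreal (s * f z) \<partial>pair_law p \<kappa>)" if "s = 1 \<or> s = -1" for s
    unfolding Gnn[OF that, symmetric]
    by (rule integral_eq_nn_integral) (auto intro!: AE_I2 G_nonneg)
  \<comment> \<open>the value 0 where a part is infinite is the default value of a nonexistent Bochner integral\<close>
  define H where "H x = p x * (if F 1 x < \<infinity> \<and> F (-1) x < \<infinity> then enn2real (F 1 x) - enn2real (F (-1) x) else 0)" for x
  have [measurable]: "H \<in> borel_measurable Leb" unfolding H_def by measurable
  have H: "H x = p x * (LINT e|\<kappa> x. f (x, e))" if x: "x \<in> {-1..1}" for x
  proof -
    have "(\<lambda>e. f (x, e)) \<in> borel_measurable (\<kappa> x)"
      by (rule kernel_slice_measurable[OF \<kappa> f x])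
    then have iff: "integrable (\<kappa> x) (\<lambda>e. f (x, e)) \<longleftrightarrow> F 1 x < \<infinity> \<and> F (-1) x < \<infinity>"
      unfolding real_integrable_def by (auto simp: F_def less_top)
    show ?thesis
      using real_lebesgue_integral_def[of "\<kappa> x" "\<lambda>e. f (x, e)"] not_integrable_integral_eq[of "\<kappa> x" "\<lambda>e. f (x, e)"]
      unfolding H_def iff[symmetric] by (simp add: F_def)
  qed
  have "H \<in> borel_measurable Leb \<longleftrightarrow> (\<lambda>x. p x * (LINT e|\<kappa> x. f (x, e))) \<in> borel_measurable Leb"
    by (rule measurable_cong) (simp add: H)
  then show "(\<lambda>x. p x * (LINT e|\<kappa> x. f (x, e))) \<in> borel_measurable Leb" by simp
  have "(LINT z|pair_law p \<kappa>. f z) = (LINT x|Leb. G 1 x) - (LINT x|Leb. G (-1) x)"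
    using real_lebesgue_integral_def[OF int] GL[of 1] GL[of "-1"] by simp
  also have "\<dots> = (LINT x|Leb. G 1 x - G (-1) x)"
    using Gint[of 1] Gint[of "-1"] by simp
  also have "\<dots> = (LINT x|Leb. H x)"
  proof (rule integral_cong_AE)
    show "AE x in Leb. G 1 x - G (-1) x = H x"
      using Ffin[of 1, simplified] Ffin[of "-1", simplified]
      by eventually_elim (simp add: G_def H_def right_diff_distrib)
  qed measurable
  also have "\<dots> = (LINT x|Leb. p x * (LINT e|\<kappa> x. f (x, e)))"
    by (rule Bochner_Integration.integral_cong[OF refl]) (simp add: H)
  finally show "(LINT z|pair_law p \<kappa>. f z) = (LINT x|Leb. p x * (LINT e|\<kappa> x. f (x, e)))" .
qed

section \<open>Scores and errors of the Gram matrix\<close>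

definition score :: "nat \<Rightarrow> (real \<Rightarrow> real) \<Rightarrow> (real \<Rightarrow> real) \<Rightarrow> nat \<Rightarrow> real \<times> real \<Rightarrow> real" where
  "score K m p j z = resid K m z * ((1/2) / p (fst z)) * fst z ^ j"

definition gram_error :: "nat \<Rightarrow> (real \<Rightarrow> real) \<Rightarrow> nat \<Rightarrow> nat \<Rightarrow> real \<times> real \<Rightarrow> real" where
  "gram_error K p j k z = (1/2) / p (fst z) * fst z ^ (j + k) - Q_mat K $$ (j, k)"

text \<open>This is \<open>\<integral> E(e\<^sup>4 | X = x) dx\<close> with the residual \<open>e\<close>. The integral is against Lebesgue measure and not
against the law of the covariate, so that constants built from it are the same for all design densities.\<close>

definition resid_fourth :: "nat \<Rightarrow> (real \<Rightarrow> real) \<Rightarrow> (real \<Rightarrow> real measure) \<Rightarrow> real" where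
  "resid_fourth K m \<kappa> = enn2real (\<integral>\<^sup>+x. (\<integral>\<^sup>+e. ennreal (resid K m (x, e) ^ 4) \<partial>\<kappa> x) \<partial>Leb)"

locale sampling_design =
  fixes K :: nat and \<epsilon> :: real and m :: "real \<Rightarrow> real" and \<kappa> :: "real \<Rightarrow> real measure"
    and p :: "real \<Rightarrow> real"
  assumes kernel: "\<kappa> \<in> Leb \<rightarrow>\<^sub>M prob_algebra borel"
    and noise_mean: "AE x in Leb. has_bochner_integral (\<kappa> x) (\<lambda>e. e) 0"
    and m_int: "integrable Leb m"
    and eps: "\<epsilon> > 0" and lower: "\<And>x. x \<in> {-1..1} \<Longrightarrow> \<epsilon> < p x"
    and density: "has_bochner_integral Leb p 1"
    and resid4: "integrable (pair_law p \<kappa>) (\<lambda>z. resid K m z ^ 4)"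
begin

abbreviation "P \<equiv> pair_law p \<kappa>"

lemma p_meas [measurable]: "p \<in> borel_measurable Leb"
  using density by (auto dest: borel_measurable_has_bochner_integral)

lemma m_meas [measurable]: "m \<in> borel_measurable Leb"
  using m_int by auto

lemma p_pos: "x \<in> {-1..1} \<Longrightarrow> 0 < p x"
  using lower eps by force

lemma sets_P [measurable_cong]: "sets P = sets (Leb \<Otimes>\<^sub>M borel)"
  by (rule sets_pair_law[OF kernel])

lemma space_P: "space P = {-1..1} \<times> UNIV"
  using sets_eq_imp_space_eq[OF sets_P] by (simp add: space_pair_measure)

lemma prob_space_P: "prob_space P"
proof
  have "emeasure P (space P) = (\<integral>\<^sup>+z. 1 \<partial>P)" by simp
  also have "\<dots> = (\<integral>\<^sup>+x. ennreal (p x) * (\<integral>\<^sup>+e. 1 \<partial>\<kappa> x) \<partial>Leb)"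
    by (rule nn_integral_pair_law[OF kernel p_meas]) simp
  also have "\<dots> = (\<integral>\<^sup>+x. ennreal (p x) \<partial>Leb)"
    by (intro nn_integral_cong)
       (use prob_space.emeasure_space_1[OF prob_kernel(1)[OF kernel]] in simp)
  also have "\<dots> = ennreal (LINT x|Leb. p x)"
    using density p_pos by (intro nn_integral_eq_integral AE_I2) (auto simp: has_bochner_integral_iff less_imp_le)
  also have "\<dots> = 1" using density by (simp add: has_bochner_integral_iff)
  finally show "emeasure P (space P) = 1" .
qed

lemma score_meas [measurable]: "score K m p j \<in> borel_measurable (Leb \<Otimes>\<^sub>M borel)"
  unfolding score_def by measurable

lemma gram_error_meas [measurable]: "gram_error K p j k \<in> borel_measurable (Leb \<Otimes>\<^sub>M borel)"
  unfolding gram_error_def by measurable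

text \<open>The weight \<open>p\<close> is at least \<open>\<epsilon>\<close>, so the fourth moment of the residual under the design dominates \<open>\<epsilon>\<close> times the unweighted integral.\<close>

lemma resid_fourth_finite: 
  "(\<integral>\<^sup>+x. (\<integral>\<^sup>+e. ennreal (resid K m (x, e) ^ 4) \<partial>\<kappa> x) \<partial>Leb) < \<infinity>" (is "?I < _")
proof -
  have m: "(\<lambda>z. ennreal (resid K m z ^ 4)) \<in> borel_measurable (Leb \<Otimes>\<^sub>M borel)" by measurable
  have "ennreal \<epsilon> * ?I = (\<integral>\<^sup>+x. ennreal \<epsilon> * (\<integral>\<^sup>+e. ennreal (resid K m (x, e) ^ 4) \<partial>\<kappa> x) \<partial>Leb)"
    by (rule nn_integral_cmult[symmetric]) (rule inner_nn_integral_measurable[OF kernel m])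
  also have "\<dots> \<le> (\<integral>\<^sup>+x. ennreal (p x) * (\<integral>\<^sup>+e. ennreal (resid K m (x, e) ^ 4) \<partial>\<kappa> x) \<partial>Leb)"
    by (intro nn_integral_mono mult_right_mono ennreal_leI) (use lower in \<open>auto simp: less_imp_le\<close>)
  also have "\<dots> = (\<integral>\<^sup>+z. ennreal (resid K m z ^ 4) \<partial>P)"
    by (rule nn_integral_pair_law[OF kernel p_meas m, symmetric])
  also have "\<dots> < \<infinity>"
    using resid4 by (simp add: integrable_iff_bounded)
  finally show ?thesis using eps by (auto simp: ennreal_mult_less_top)
qed

text \<open>Integrating against the law contributes one factor \<open>p\<close> and the score four factors \<open>(1/2) / p\<close>, which leaves
\<open>1 / (16 p\<^sup>3) \<le> 1 / (16 \<epsilon>\<^sup>3)\<close> in front of the conditional fourth moment of the residual.\<close>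

lemma score_fourth:
  shows "integrable P (\<lambda>z. score K m p j z ^ 4)"
    and "(LINT z|P. score K m p j z ^ 4) \<le> resid_fourth K m \<kappa> / (16 * \<epsilon> ^ 3)"
proof -
  let ?I = "\<integral>\<^sup>+x. (\<integral>\<^sup>+e. ennreal (resid K m (x, e) ^ 4) \<partial>\<kappa> x) \<partial>Leb"
  have m: "(\<lambda>z. ennreal (resid K m z ^ 4)) \<in> borel_measurable (Leb \<Otimes>\<^sub>M borel)" by measurable
  have "(\<integral>\<^sup>+z. ennreal (score K m p j z ^ 4) \<partial>P) =
    (\<integral>\<^sup>+x. ennreal (p x) * (\<integral>\<^sup>+e. ennreal (score K m p j (x, e) ^ 4) \<partial>\<kappa> x) \<partial>Leb)"
    by (rule nn_integral_pair_law[OF kernel p_meas]) measurable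
  also have "\<dots> \<le> (\<integral>\<^sup>+x. ennreal (1 / (16 * \<epsilon> ^ 3)) * (\<integral>\<^sup>+e. ennreal (resid K m (x, e) ^ 4) \<partial>\<kappa> x) \<partial>Leb)"
  proof (rule nn_integral_mono)
    fix x :: real assume "x \<in> space Leb"
    then have x: "x \<in> {-1..1}" by simp
    have px: "0 < p x" "\<epsilon> < p x" using p_pos[OF x] lower[OF x] by auto
    have xj: "(x ^ j) ^ 4 \<le> 1"
    proof -
      have "\<bar>x\<bar> ^ (j * 4) \<le> 1" using x by (intro power_le_one) auto
      then show ?thesis using x by (simp add: power_mult power_even_abs flip: power_abs)
    qed
    have "(\<integral>\<^sup>+e. ennreal (score K m p j (x, e) ^ 4) \<partial>\<kappa> x) \<le>
        (\<integral>\<^sup>+e. ennreal ((1/2 / p x) ^ 4) * ennreal (resid K m (x, e) ^ 4) \<partial>\<kappa> x)"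
    proof (rule nn_integral_mono)
      fix e
      have "score K m p j (x, e) ^ 4 = ((1/2 / p x) ^ 4 * resid K m (x, e) ^ 4) * (x ^ j) ^ 4"
        unfolding score_def power_mult_distrib by (simp add: mult_ac)
      also have "\<dots> \<le> ((1/2 / p x) ^ 4 * resid K m (x, e) ^ 4) * 1"
        by (rule mult_left_mono[OF xj]) simp
      finally show "ennreal (score K m p j (x, e) ^ 4) \<le> ennreal ((1/2 / p x) ^ 4) * ennreal (resid K m (x, e) ^ 4)"
        by (simp add: ennreal_leI flip: ennreal_mult)
    qed
    also have "\<dots> = ennreal ((1/2 / p x) ^ 4) * (\<integral>\<^sup>+e. ennreal (resid K m (x, e) ^ 4) \<partial>\<kappa> x)"
      by (rule nn_integral_cmult) (rule kernel_slice_measurable[OF kernel m x])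
    finally have "ennreal (p x) * (\<integral>\<^sup>+e. ennreal (score K m p j (x, e) ^ 4) \<partial>\<kappa> x) \<le>
      ennreal (p x) * (ennreal ((1/2 / p x) ^ 4) * (\<integral>\<^sup>+e. ennreal (resid K m (x, e) ^ 4) \<partial>\<kappa> x))"
      by (rule mult_left_mono) simp
    also have "\<dots> = ennreal (p x * (1/2 / p x) ^ 4) * (\<integral>\<^sup>+e. ennreal (resid K m (x, e) ^ 4) \<partial>\<kappa> x)"
      using px by (simp add: ennreal_mult mult.assoc)
    also have "\<dots> \<le> ennreal (1 / (16 * \<epsilon> ^ 3)) * (\<integral>\<^sup>+e. ennreal (resid K m (x, e) ^ 4) \<partial>\<kappa> x)"
    proof (intro mult_right_mono ennreal_leI)
      have "p x * (1/2 / p x) ^ 4 = 1 / (16 * p x ^ 3)"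
        using px by (simp add: power4_eq_xxxx power3_eq_cube field_simps)
      also have "\<dots> \<le> 1 / (16 * \<epsilon> ^ 3)"
        using px eps by (intro divide_left_mono mult_left_mono power_mono) auto
      finally show "p x * (1/2 / p x) ^ 4 \<le> 1 / (16 * \<epsilon> ^ 3)" .
    qed simp
    finally show "ennreal (p x) * (\<integral>\<^sup>+e. ennreal (score K m p j (x, e) ^ 4) \<partial>\<kappa> x) \<le>
      ennreal (1 / (16 * \<epsilon> ^ 3)) * (\<integral>\<^sup>+e. ennreal (resid K m (x, e) ^ 4) \<partial>\<kappa> x)" .
  qed
  also have "\<dots> = ennreal (1 / (16 * \<epsilon> ^ 3)) * ?I"
    by (rule nn_integral_cmult) (rule inner_nn_integral_measurable[OF kernel m])
  also have "\<dots> = ennreal (resid_fourth K m \<kappa> / (16 * \<epsilon> ^ 3))"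
  proof -
    have "?I = ennreal (resid_fourth K m \<kappa>)" "0 \<le> resid_fourth K m \<kappa>"
      using resid_fourth_finite unfolding resid_fourth_def by auto
    then show ?thesis using eps by (simp flip: ennreal_mult)
  qed
  finally have le: "(\<integral>\<^sup>+z. ennreal (score K m p j z ^ 4) \<partial>P) \<le> ennreal (resid_fourth K m \<kappa> / (16 * \<epsilon> ^ 3))" .
  show "integrable P (\<lambda>z. score K m p j z ^ 4)"
    by (rule integrableI_nonneg) (use le in \<open>auto simp: less_top[symmetric] top_unique\<close>)
  show "(LINT z|P. score K m p j z ^ 4) \<le> resid_fourth K m \<kappa> / (16 * \<epsilon> ^ 3)"
    by (rule integral_real_bounded[OF _ le]) (use eps in \<open>simp add: resid_fourth_def\<close>)
qed

lemma gram_error_bound: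
  assumes "z \<in> space P"
  shows "\<bar>gram_error K p j k z\<bar> \<le> 1 / (2 * \<epsilon>) + \<bar>Q_mat K $$ (j, k)\<bar>"
proof -
  have x: "fst z \<in> {-1..1}" using assms by (auto simp: space_P)
  have "\<bar>fst z ^ (j + k)\<bar> \<le> 1" using x unfolding power_abs by (intro power_le_one) auto
  moreover have "\<bar>(1/2) / p (fst z)\<bar> \<le> 1 / (2 * \<epsilon>)"
    using lower[OF x] eps by (simp add: frac_le)
  ultimately have "\<bar>(1/2) / p (fst z) * fst z ^ (j + k)\<bar> \<le> 1 / (2 * \<epsilon>) * 1"
    unfolding abs_mult by (intro mult_mono) (use eps in auto)
  then show ?thesis unfolding gram_error_def by linarith
qed

lemma gram_error_fourth:
  shows "integrable P (\<lambda>z. gram_error K p j k z ^ 4)"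
    and "(LINT z|P. gram_error K p j k z ^ 4) \<le> (1 / (2 * \<epsilon>) + \<bar>Q_mat K $$ (j, k)\<bar>) ^ 4"
proof -
  interpret P: prob_space P by (rule prob_space_P)
  let ?H = "(1 / (2 * \<epsilon>) + \<bar>Q_mat K $$ (j, k)\<bar>) ^ 4"
  have le: "gram_error K p j k z ^ 4 \<le> ?H" if "z \<in> space P" for z
    using power_mono[OF gram_error_bound[OF that, of j k], of 4] by (simp add: power_even_abs)
  show i: "integrable P (\<lambda>z. gram_error K p j k z ^ 4)"
    by (rule P.integrable_const_bound[of _ ?H]) (auto intro!: AE_I2 le)
  show "(LINT z|P. gram_error K p j k z ^ 4) \<le> ?H"
    by (rule P.integral_le_const[OF i]) (auto intro!: AE_I2 le)
qed

lemma gram_error_mean: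
  assumes "j < K + 1" "k < K + 1"
  shows "(LINT z|P. gram_error K p j k z) = 0"
proof -
  interpret P: prob_space P by (rule prob_space_P)
  have int: "integrable P (\<lambda>z. gram_error K p j k z)"
    using P.integrable_power_of_fourth[OF _ gram_error_fourth(1), of j k 1] by simp
  have "(LINT z|P. gram_error K p j k z) = (LINT x|Leb. p x * (LINT e|\<kappa> x. gram_error K p j k (x, e)))"
    by (rule integral_pair_law(2)[OF kernel p_meas p_pos int])
  also have "\<dots> = (LINT x|Leb. 1/2 * x ^ (j + k) - Q_mat K $$ (j, k) * p x)"
  proof (rule Bochner_Integration.integral_cong[OF refl])
    fix x :: real assume "x \<in> space Leb"
    then have x: "x \<in> {-1..1}" by simp
    interpret \<kappa>: prob_space "\<kappa> x" by (rule prob_kernel[OF kernel x])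
    show "p x * (LINT e|\<kappa> x. gram_error K p j k (x, e)) = 1/2 * x ^ (j + k) - Q_mat K $$ (j, k) * p x"
      using p_pos[OF x] unfolding gram_error_def by (simp add: \<kappa>.prob_space field_simps)
  qed
  also have "\<dots> = (LINT x|Leb. 1/2 * x ^ (j + k)) - Q_mat K $$ (j, k) * (LINT x|Leb. p x)"
    using density integrable_Leb_power[of "j + k"] by (simp add: has_bochner_integral_iff)
  finally show ?thesis using density Q_mat_entry[OF assms] by (simp add: has_bochner_integral_iff)
qed

text \<open>The noise averages out, and the density cancels the inverse weight, leaving \<open>\<integral> x\<^sup>j (m - \<ell>) / 2 dx\<close>. This vanishes since the
equations \<open>Q \<beta> = \<integral> x\<^sup>j m / 2 dx\<close> defining \<open>\<beta>\<close> say that \<open>m - \<ell>\<close> is orthogonal to the monomials.\<close>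

lemma score_mean:
  assumes j: "j < K + 1"
  shows "(LINT z|P. score K m p j z) = 0"
proof -
  interpret P: prob_space P by (rule prob_space_P)
  have int: "integrable P (\<lambda>z. score K m p j z)"
    using P.integrable_power_of_fourth[OF _ score_fourth(1), of j 1] by simp
  have kmeas: "(\<lambda>x. p x * (LINT e|\<kappa> x. score K m p j (x, e))) \<in> borel_measurable Leb"
    by (rule integral_pair_law(1)[OF kernel p_meas p_pos int])
  have "(LINT z|P. score K m p j z) = (LINT x|Leb. p x * (LINT e|\<kappa> x. score K m p j (x, e)))"
    by (rule integral_pair_law(2)[OF kernel p_meas p_pos int])
  also have "\<dots> = (LINT x|Leb. 1/2 * (x ^ j * m x) - 1/2 * (x ^ j * ell K m x))"
  proof (rule integral_cong_AE[OF kmeas])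
    show "AE x in Leb. p x * (LINT e|\<kappa> x. score K m p j (x, e)) = 1/2 * (x ^ j * m x) - 1/2 * (x ^ j * ell K m x)"
      using noise_mean AE_space
    proof eventually_elim
      case (elim x)
      then have x: "x \<in> {-1..1}" by simp
      interpret \<kappa>: prob_space "\<kappa> x" by (rule prob_kernel[OF kernel x])
      have e: "integrable (\<kappa> x) (\<lambda>e. e)" "(LINT e|\<kappa> x. e) = 0"
        using elim by (auto simp: has_bochner_integral_iff)
      have "(LINT e|\<kappa> x. score K m p j (x, e)) =
          (LINT e|\<kappa> x. ((m x - ell K m x) + e) * ((1/2) / p x * x ^ j))"
        by (intro Bochner_Integration.integral_cong refl) (simp only: score_def resid_eq fst_conv snd_conv mult.assoc diff_add_eq)
      also have "\<dots> = (LINT e|\<kappa> x. (m x - ell K m x) + e) * ((1/2) / p x * x ^ j)"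
        by (rule integral_mult_left_zero)
      also have "\<dots> = (m x - ell K m x) * ((1/2) / p x * x ^ j)"
        using e by (simp add: \<kappa>.prob_space)
      finally have E: "(LINT e|\<kappa> x. score K m p j (x, e)) = (m x - ell K m x) * ((1/2) / p x * x ^ j)" .
      show ?case unfolding E using p_pos[OF x] by (simp add: field_simps)
    qed
  qed measurable
  also have "\<dots> = (LINT x|Leb. 1/2 * (x ^ j * m x)) - (LINT x|Leb. 1/2 * (x ^ j * ell K m x))"
    using integrable_Leb_power_mult[OF m_int] integrable_Leb_power_mult[OF integrable_ell] by simp
  also have "(LINT x|Leb. 1/2 * (x ^ j * ell K m x)) = (\<Sum>k<K + 1. Q_mat K $$ (j, k) * beta K m $ k)"
  proof -
    have "(LINT x|Leb. 1/2 * (x ^ j * ell K m x)) = (LINT x|Leb. (\<Sum>k<K + 1. 1/2 * x ^ (j + k) * beta K m $ k))"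
      unfolding ell_eq by (intro Bochner_Integration.integral_cong refl)
        (simp only: sum_distrib_left power_add mult_ac)
    also have "\<dots> = (\<Sum>k<K + 1. (LINT x|Leb. 1/2 * x ^ (j + k) * beta K m $ k))"
      using integrable_Leb_power by (intro Bochner_Integration.integral_sum) simp
    also have "\<dots> = (\<Sum>k<K + 1. Q_mat K $$ (j, k) * beta K m $ k)"
      by (intro sum.cong refl) (use j in \<open>simp only: Q_mat_entry lessThan_iff, simp\<close>)
    finally show ?thesis .
  qed
  finally show ?thesis unfolding Q_mat_beta[OF j] by simp
qed

end


section \<open>Determinants and inverses of random matrices\<close>

lemma det_measurable:
  assumes "\<And>\<omega>. A \<omega> \<in> carrier_mat d d"
    and "\<And>i j. i < d \<Longrightarrow> j < d \<Longrightarrow> (\<lambda>\<omega>. A \<omega> $$ (i, j) :: real) \<in> borel_measurable M"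
  shows "(\<lambda>\<omega>. det (A \<omega>)) \<in> borel_measurable M"
  unfolding det_def'[OF assms(1)]
proof (intro borel_measurable_sum borel_measurable_times borel_measurable_prod assms(2))
  fix \<pi> i assume "\<pi> \<in> {\<pi>. \<pi> permutes {0..<d}}" "i \<in> {0..<d}"
  then show "i < d" "\<pi> i < d" using permutes_in_image[of \<pi> "{0..<d}" i] by auto
qed simp

lemma adj_mat_measurable:
  assumes A: "\<And>\<omega>. A \<omega> \<in> carrier_mat d d"
    and m: "\<And>i j. i < d \<Longrightarrow> j < d \<Longrightarrow> (\<lambda>\<omega>. A \<omega> $$ (i, j) :: real) \<in> borel_measurable M"
    and ij: "i < d" "j < d"
  shows "(\<lambda>\<omega>. adj_mat (A \<omega>) $$ (i, j)) \<in> borel_measurable M"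
proof -
  have "(\<lambda>\<omega>. det (mat_delete (A \<omega>) j i)) \<in> borel_measurable M"
  proof (rule det_measurable)
    show "mat_delete (A \<omega>) j i \<in> carrier_mat (d - 1) (d - 1)" for \<omega>
      using A[of \<omega>] unfolding mat_delete_def by auto
    fix k l assume "k < d - 1" "l < d - 1"
    then show "(\<lambda>\<omega>. mat_delete (A \<omega>) j i $$ (k, l)) \<in> borel_measurable M"
      using A[THEN carrier_matD(1)] A[THEN carrier_matD(2)] m unfolding mat_delete_def by auto
  qed
  moreover have "adj_mat (A \<omega>) $$ (i, j) = (-1) ^ (j + i) * det (mat_delete (A \<omega>) j i)" for \<omega>
    using A[of \<omega>] ij unfolding adj_mat_def cofactor_def by auto
  ultimately show ?thesis by simp
qed

text \<open>The entries of the adjugate and the determinant are polynomials in the entries of \<open>A\<close>, so this formula transfers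
measurability from a matrix to its inverse, which the definition by Gauss-Jordan elimination does not.\<close>

lemma inverse_eq_adj_mat:
  fixes A :: "real mat"
  assumes A: "A \<in> carrier_mat d d" and B: "B \<in> carrier_mat d d" "B * A = 1\<^sub>m d" and det: "det A \<noteq> 0"
    and ij: "i < d" "j < d"
  shows "B $$ (i, j) = adj_mat A $$ (i, j) / det A"
proof -
  have adj: "adj_mat A \<in> carrier_mat d d" by (rule adj_mat(1)[OF A])
  have "adj_mat A = (B * A) * adj_mat A" using adj B(2) by simp
  also have "\<dots> = B * (A * adj_mat A)" by (rule assoc_mult_mat[OF B(1) A adj])
  also have "\<dots> = det A \<cdot>\<^sub>m B"
    unfolding adj_mat(2)[OF A] using B(1) by (simp add: mult_smult_distrib[OF B(1) one_carrier_mat])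
  finally have "adj_mat A $$ (i, j) = det A * B $$ (i, j)" using B(1) ij by simp
  then show ?thesis using det by simp
qed

section \<open>The error of the estimated coefficients\<close>

lemma gram_carrier: "gram K p n \<omega> \<in> carrier_mat (K + 1) (K + 1)"
  unfolding gram_def design_def by (intro carrier_matI) auto

lemma design_weights_eq:
  "(design K n \<omega>)\<^sup>T * weights p n \<omega> = mat (K + 1) n (\<lambda>(j, i). fst (\<omega> i) ^ j * ((1/2) / p (fst (\<omega> i))))"
  unfolding weights_def
  by (subst mat_diag_mult_right[of _ "K + 1"]) (auto simp: design_def powers_entry intro!: eq_matI)

lemma gram_entry:
  assumes "j < K + 1" "k < K + 1"
  shows "gram K p n \<omega> $$ (j, k) = (\<Sum>i<n. (1/2) / p (fst (\<omega> i)) * fst (\<omega> i) ^ (j + k))"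
  unfolding gram_def design_weights_eq using assms
  by (auto simp: scalar_prod_def design_def powers_entry power_add atLeast0LessThan intro!: sum.cong)

lemma V_tilde_carrier: "V_tilde K m p n \<omega> \<in> carrier_vec (K + 1)"
  unfolding V_tilde_def design_weights_eq by (intro carrier_vecI) simp

lemma V_tilde_entry:
  assumes "j < K + 1"
  shows "V_tilde K m p n \<omega> $ j = (\<Sum>i<n. fst (\<omega> i) ^ j * ((1/2) / p (fst (\<omega> i))) * response m (\<omega> i))"
  unfolding V_tilde_def design_weights_eq using assms
  by (auto simp: scalar_prod_def responses_def atLeast0LessThan intro!: sum.cong)

abbreviation mean_gram :: "nat \<Rightarrow> (real \<Rightarrow> real) \<Rightarrow> nat \<Rightarrow> (nat \<Rightarrow> real \<times> real) \<Rightarrow> real mat" where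
  "mean_gram K p n \<omega> \<equiv> (1 / real n) \<cdot>\<^sub>m gram K p n \<omega>"

lemma mean_gram_carrier: "mean_gram K p n \<omega> \<in> carrier_mat (K + 1) (K + 1)"
  using gram_carrier by simp

lemma mean_gram_entry:
  assumes "j < K + 1" "k < K + 1"
  shows "mean_gram K p n \<omega> $$ (j, k) = (\<Sum>i<n. (1/2) / p (fst (\<omega> i)) * fst (\<omega> i) ^ (j + k)) / real n"
  using gram_carrier[of K p n \<omega>] assms gram_entry[OF assms] by simp

lemma mean_gram_sym: "\<forall>i<K + 1. \<forall>j<K + 1. mean_gram K p n \<omega> $$ (i, j) = mean_gram K p n \<omega> $$ (j, i)"
proof (intro allI impI)
  fix i j assume "i < K + 1" "j < K + 1"
  then show "mean_gram K p n \<omega> $$ (i, j) = mean_gram K p n \<omega> $$ (j, i)"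
    by (simp only: mean_gram_entry add.commute[of i j])
qed

lemma mean_gram_minus_Q:
  assumes "n \<ge> 1" "j < K + 1" "k < K + 1"
  shows "mean_gram K p n \<omega> $$ (j, k) - Q_mat K $$ (j, k) = sample_mean n (gram_error K p j k) \<omega>"
  unfolding mean_gram_entry[OF assms(2,3)] sample_mean_def gram_error_def sum_subtractf
  using assms(1) by (simp add: diff_divide_distrib)

text \<open>Splitting the responses as residual plus \<open>\<ell>\<close> splits \<open>X\<^sup>T W Y / n\<close> as \<open>U + S \<beta>\<close>.\<close>

lemma mean_response_decomposition:
  assumes "n \<ge> 1" "j < K + 1"
  shows "V_tilde K m p n \<omega> $ j = real n * (sample_mean n (score K m p j) \<omega> +
    (\<Sum>k<K + 1. mean_gram K p n \<omega> $$ (j, k) * beta K m $ k))"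
proof -
  have "V_tilde K m p n \<omega> $ j = (\<Sum>i<n. score K m p j (\<omega> i) +
      (\<Sum>k<K + 1. (1/2) / p (fst (\<omega> i)) * fst (\<omega> i) ^ (j + k) * beta K m $ k))"
  proof (unfold V_tilde_entry[OF assms(2)], intro sum.cong refl)
    fix i assume "i \<in> {..<n}"
    define x where "x = fst (\<omega> i)"
    have alg: "a * w * (r + l) = r * w * a + a * w * l" for a w r l :: real
      by (simp add: algebra_simps)
    have resp: "response m (\<omega> i) = resid K m (\<omega> i) + ell K m x"
      unfolding resid_def ell_def x_def by simp
    have "x ^ j * ((1/2) / p x) * response m (\<omega> i) = score K m p j (\<omega> i) + x ^ j * ((1/2) / p x) * ell K m x"
      unfolding resp unfolding score_def x_def by (rule alg)
    also have "x ^ j * ((1/2) / p x) * ell K m x = (\<Sum>k<K + 1. (1/2) / p x * x ^ (j + k) * beta K m $ k)"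
      unfolding ell_eq by (simp only: sum_distrib_left power_add mult_ac)
    finally show "fst (\<omega> i) ^ j * ((1/2) / p (fst (\<omega> i))) * response m (\<omega> i) = score K m p j (\<omega> i) +
      (\<Sum>k<K + 1. (1/2) / p (fst (\<omega> i)) * fst (\<omega> i) ^ (j + k) * beta K m $ k)"
      unfolding x_def .
  qed
  also have "\<dots> = (\<Sum>i<n. score K m p j (\<omega> i)) +
      (\<Sum>k<K + 1. (\<Sum>i<n. (1/2) / p (fst (\<omega> i)) * fst (\<omega> i) ^ (j + k)) * beta K m $ k)"
    unfolding sum.distrib by (subst sum.swap) (simp only: sum_distrib_right)
  also have "(\<Sum>i<n. score K m p j (\<omega> i)) = real n * sample_mean n (score K m p j) \<omega>"
    using assms(1) unfolding sample_mean_def by simp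
  also have "(\<Sum>k<K + 1. (\<Sum>i<n. (1/2) / p (fst (\<omega> i)) * fst (\<omega> i) ^ (j + k)) * beta K m $ k) =
      real n * (\<Sum>k<K + 1. mean_gram K p n \<omega> $$ (j, k) * beta K m $ k)"
    unfolding sum_distrib_left
    by (intro sum.cong refl) (use assms in \<open>simp only: mean_gram_entry lessThan_iff, simp\<close>)
  finally show ?thesis by (simp only: distrib_left)
qed

definition coef_error ::
  "nat \<Rightarrow> (real \<Rightarrow> real) \<Rightarrow> (real \<Rightarrow> real) \<Rightarrow> nat \<Rightarrow> (nat \<Rightarrow> real \<times> real) \<Rightarrow> nat \<Rightarrow> real" where
  "coef_error K m p n \<omega> j = beta_tilde K m p n \<omega> $ j - beta K m $ j"

lemma bad_event_iff:
  "\<omega> \<in> bad_event K p n \<longleftrightarrow> (\<exists>v. bilin (K + 1) (entries (mean_gram K p n \<omega>)) v v < lambda_min (Q_mat K) / 2 * dot (K + 1) v v)"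
  unfolding bad_event_def mem_Collect_eq
  by (rule lambda_min_less_iff[OF mean_gram_carrier _ mean_gram_sym]) simp

text \<open>The truncation makes \<open>Q_tilde\<close> coercive on either side of the event, with constant \<open>n \<lambda>\<^sub>m\<^sub>i\<^sub>n(Q) / 2\<close>.\<close>

lemma Q_tilde_inverse:
  assumes n: "n \<ge> 1"
  shows "Q_tilde K p n \<omega> \<in> carrier_mat (K + 1) (K + 1)"
    and "inv_mat (Q_tilde K p n \<omega>) \<in> carrier_mat (K + 1) (K + 1)"
    and "Q_tilde K p n \<omega> * inv_mat (Q_tilde K p n \<omega>) = 1\<^sub>m (K + 1)"
    and "inv_mat (Q_tilde K p n \<omega>) * Q_tilde K p n \<omega> = 1\<^sub>m (K + 1)"
    and "det (Q_tilde K p n \<omega>) \<noteq> 0"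
proof -
  let ?l = "lambda_min (Q_mat K)"
  have l: "?l > 0" by (rule lambda_min_Q_mat_pos)
  define A where "A = (if \<omega> \<in> bad_event K p n then Q_mat K else mean_gram K p n \<omega>)"
  have A: "A \<in> carrier_mat (K + 1) (K + 1)"
    unfolding A_def using Q_mat_carrier mean_gram_carrier by simp
  have coer: "?l / 2 * dot (K + 1) v v \<le> bilin (K + 1) (entries A) v v" for v
  proof (cases "\<omega> \<in> bad_event K p n")
    case True
    have "0 \<le> ?l * dot (K + 1) v v" using l dot_self_nonneg by simp
    then show ?thesis using True bilin_Q_mat_coercive[of K v] unfolding A_def by simp
  next
    case False
    then have "?l / 2 * dot (K + 1) v v \<le> bilin (K + 1) (entries (mean_gram K p n \<omega>)) v v"
      unfolding bad_event_iff not_ex not_less by blast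
    with False show ?thesis unfolding A_def by simp
  qed
  have eq: "Q_tilde K p n \<omega> = real n \<cdot>\<^sub>m A"
    using n unfolding Q_tilde_def A_def by (auto intro!: eq_matI)
  then show car: "Q_tilde K p n \<omega> \<in> carrier_mat (K + 1) (K + 1)" using A by simp
  have "real n * (?l / 2) * dot (K + 1) v v \<le> bilin (K + 1) (entries (Q_tilde K p n \<omega>)) v v" for v
  proof -
    have "bilin (K + 1) (entries (Q_tilde K p n \<omega>)) v v = real n * bilin (K + 1) (entries A) v v"
      unfolding bilin_def sum_distrib_left eq using A by (intro sum.cong refl) auto
    then show ?thesis using mult_left_mono[OF coer[of v], of "real n"] by (simp add: mult_ac)
  qed
  moreover have "real n * (?l / 2) > 0" using l n by simp
  ultimately show "inv_mat (Q_tilde K p n \<omega>) \<in> carrier_mat (K + 1) (K + 1)"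
    "Q_tilde K p n \<omega> * inv_mat (Q_tilde K p n \<omega>) = 1\<^sub>m (K + 1)"
    "inv_mat (Q_tilde K p n \<omega>) * Q_tilde K p n \<omega> = 1\<^sub>m (K + 1)"
    "det (Q_tilde K p n \<omega>) \<noteq> 0"
    using inv_mat_coercive[OF car] by blast+
qed

lemma beta_tilde_carrier:
  "n \<ge> 1 \<Longrightarrow> beta_tilde K m p n \<omega> \<in> carrier_vec (K + 1)"
  unfolding beta_tilde_def using Q_tilde_inverse(2) V_tilde_carrier by (rule mult_mat_vec_carrier)

lemma normal_equations:
  assumes n: "n \<ge> 1" and j: "j < K + 1"
  shows "(\<Sum>k<K + 1. Q_tilde K p n \<omega> $$ (j, k) * beta_tilde K m p n \<omega> $ k) = V_tilde K m p n \<omega> $ j"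
proof -
  note Q = Q_tilde_inverse[OF n, of K p \<omega>]
  have "Q_tilde K p n \<omega> *\<^sub>v beta_tilde K m p n \<omega> = (Q_tilde K p n \<omega> * inv_mat (Q_tilde K p n \<omega>)) *\<^sub>v V_tilde K m p n \<omega>"
    unfolding beta_tilde_def by (rule assoc_mult_mat_vec[OF Q(1,2) V_tilde_carrier, symmetric])
  also have "\<dots> = V_tilde K m p n \<omega>" unfolding Q(3) using V_tilde_carrier by simp
  finally show ?thesis
    unfolding mult_mat_vec_entry[OF Q(1) beta_tilde_carrier[OF n] j, symmetric] by simp
qed

text \<open>Subtracting \<open>S \<beta>\<close>, respectively \<open>Q \<beta>\<close>, from the normal equations gives the two linear systems of the
perturbation lemmas.\<close>

lemma coef_error_good:
  assumes n: "n \<ge> 1" and "\<omega> \<notin> bad_event K p n"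
  shows "\<forall>j<K + 1. (\<Sum>k<K + 1. mean_gram K p n \<omega> $$ (j, k) * coef_error K m p n \<omega> k) = sample_mean n (score K m p j) \<omega>"
proof (intro allI impI)
  fix j assume j: "j < K + 1"
  have Q: "Q_tilde K p n \<omega> $$ (j, k) = real n * mean_gram K p n \<omega> $$ (j, k)" if "k < K + 1" for k
    using assms j that gram_carrier[of K p n \<omega>] unfolding Q_tilde_def by simp
  have "real n * (\<Sum>k<K + 1. mean_gram K p n \<omega> $$ (j, k) * beta_tilde K m p n \<omega> $ k) = V_tilde K m p n \<omega> $ j"
    unfolding normal_equations[OF n j, symmetric] sum_distrib_left
    by (intro sum.cong refl) (simp only: Q lessThan_iff mult.assoc)
  then have "(\<Sum>k<K + 1. mean_gram K p n \<omega> $$ (j, k) * beta_tilde K m p n \<omega> $ k) =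
    sample_mean n (score K m p j) \<omega> + (\<Sum>k<K + 1. mean_gram K p n \<omega> $$ (j, k) * beta K m $ k)"
    unfolding mean_response_decomposition[OF n j] using n by simp
  then show "(\<Sum>k<K + 1. mean_gram K p n \<omega> $$ (j, k) * coef_error K m p n \<omega> k) = sample_mean n (score K m p j) \<omega>"
    unfolding coef_error_def right_diff_distrib sum_subtractf by simp
qed

lemma coef_error_bad:
  assumes n: "n \<ge> 1" and "\<omega> \<in> bad_event K p n"
  shows "\<forall>j<K + 1. (\<Sum>k<K + 1. Q_mat K $$ (j, k) * coef_error K m p n \<omega> k) = sample_mean n (score K m p j) \<omega> +
    (\<Sum>k<K + 1. (mean_gram K p n \<omega> $$ (j, k) - Q_mat K $$ (j, k)) * beta K m $ k)"
proof (intro allI impI)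
  fix j assume j: "j < K + 1"
  have Q: "Q_tilde K p n \<omega> $$ (j, k) = real n * Q_mat K $$ (j, k)" if "k < K + 1" for k
    using assms j that Q_mat_carrier[of K] unfolding Q_tilde_def by simp
  have "real n * (\<Sum>k<K + 1. Q_mat K $$ (j, k) * beta_tilde K m p n \<omega> $ k) = V_tilde K m p n \<omega> $ j"
    unfolding normal_equations[OF n j, symmetric] sum_distrib_left
    by (intro sum.cong refl) (simp only: Q lessThan_iff mult.assoc)
  then have "(\<Sum>k<K + 1. Q_mat K $$ (j, k) * beta_tilde K m p n \<omega> $ k) =
    sample_mean n (score K m p j) \<omega> + (\<Sum>k<K + 1. mean_gram K p n \<omega> $$ (j, k) * beta K m $ k)"
    unfolding mean_response_decomposition[OF n j] using n by simp
  then show "(\<Sum>k<K + 1. Q_mat K $$ (j, k) * coef_error K m p n \<omega> k) = sample_mean n (score K m p j) \<omega> +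
    (\<Sum>k<K + 1. (mean_gram K p n \<omega> $$ (j, k) - Q_mat K $$ (j, k)) * beta K m $ k)"
    unfolding coef_error_def right_diff_distrib left_diff_distrib sum_subtractf by simp
qed

text \<open>The quantity \<open>r\<close> of the perturbation lemmas: all deviations of sample means from their expectations, taken together.\<close>

definition fluctuation :: "nat \<Rightarrow> (real \<Rightarrow> real) \<Rightarrow> (real \<Rightarrow> real) \<Rightarrow> nat \<Rightarrow> (nat \<Rightarrow> real \<times> real) \<Rightarrow> real" where
  "fluctuation K m p n \<omega> = (\<Sum>j<K + 1. \<bar>sample_mean n (score K m p j) \<omega>\<bar>) +
     (\<Sum>j<K + 1. \<Sum>k<K + 1. \<bar>sample_mean n (gram_error K p j k) \<omega>\<bar>)"

definition fluctuation_fourth :: "nat \<Rightarrow> (real \<Rightarrow> real) \<Rightarrow> (real \<Rightarrow> real) \<Rightarrow> nat \<Rightarrow> (nat \<Rightarrow> real \<times> real) \<Rightarrow> real" where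
  "fluctuation_fourth K m p n \<omega> = (\<Sum>j<K + 1. sample_mean n (score K m p j) \<omega> ^ 4) +
     (\<Sum>j<K + 1. \<Sum>k<K + 1. sample_mean n (gram_error K p j k) \<omega> ^ 4)"

text \<open>The quadratic form \<open>U\<^sup>T Q\<^sup>-\<^sup>1 U\<close>.\<close>

definition main_term :: "nat \<Rightarrow> (real \<Rightarrow> real) \<Rightarrow> (real \<Rightarrow> real) \<Rightarrow> nat \<Rightarrow> (nat \<Rightarrow> real \<times> real) \<Rightarrow> real" where
  "main_term K m p n \<omega> = (\<Sum>j<K + 1. \<Sum>k<K + 1. inv_mat (Q_mat K) $$ (j, k) *
     (sample_mean n (score K m p k) \<omega> * sample_mean n (score K m p j) \<omega>))"

text \<open>The constant \<open>(2 + B)\<^sup>2\<close> dominates both \<open>2\<close> and \<open>B (2 + B)\<close>, so the two cases share one bound. The linear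
bound on the single errors serves integrability.\<close>

lemma coef_error_expansion:
  fixes K :: nat and m :: "real \<Rightarrow> real"
  defines "c \<equiv> lambda_min (Q_mat K) / 2" and "B \<equiv> \<Sum>i<K + 1. \<bar>beta K m $ i\<bar>"
  assumes n: "n \<ge> 1"
  shows "\<bar>bilin (K + 1) (entries (Q_mat K)) (coef_error K m p n \<omega>) (coef_error K m p n \<omega>) - main_term K m p n \<omega>\<bar>
      \<le> (2 + B)\<^sup>2 / c\<^sup>2 * fluctuation K m p n \<omega> ^ 3"
    and "j < K + 1 \<Longrightarrow> \<bar>coef_error K m p n \<omega> j\<bar> \<le> (1 + B) / c * fluctuation K m p n \<omega>"
proof -
  let ?Q = "entries (Q_mat K)" and ?S = "entries (mean_gram K p n \<omega>)"
  let ?U = "\<lambda>j. sample_mean n (score K m p j) \<omega>" and ?b = "coef_error K m p n \<omega>"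
  let ?r = "fluctuation K m p n \<omega>" and ?d = "K + 1"
  define q where "q j = (\<Sum>k<?d. inv_mat (Q_mat K) $$ (j, k) * ?U k)" for j
  have c: "c > 0" unfolding c_def using lambda_min_Q_mat_pos by simp
  have cQ: "2 * c * dot ?d v v \<le> bilin ?d ?Q v v" for v
    unfolding c_def using bilin_Q_mat_coercive by simp
  have cQ': "c * dot ?d v v \<le> bilin ?d ?Q v v" for v
    using cQ[of v] c mult_nonneg_nonneg[OF less_imp_le[OF c] dot_self_nonneg[of ?d v]] by linarith
  have B: "0 \<le> B" unfolding B_def by (simp add: sum_nonneg)
  have r: "?r = (\<Sum>i<?d. \<bar>?U i\<bar>) + (\<Sum>i<?d. \<Sum>j<?d. \<bar>?S i j - ?Q i j\<bar>)"
    unfolding fluctuation_def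
    by (intro arg_cong2[where f="(+)"] sum.cong refl) (simp only: mean_gram_minus_Q[OF n] lessThan_iff)
  have r0: "0 \<le> ?r" unfolding fluctuation_def by (intro add_nonneg_nonneg sum_nonneg) auto
  have sol: "\<forall>i<?d. (\<Sum>j<?d. ?Q i j * q j) = ?U i"
  proof (intro allI impI)
    fix i assume i: "i < ?d"
    have "(\<Sum>j<?d. ?Q i j * q j) = (\<Sum>k<?d. (\<Sum>j<?d. ?Q i j * inv_mat (Q_mat K) $$ (j, k)) * ?U k)"
      unfolding q_def sum_distrib_left sum_distrib_right by (subst sum.swap) (simp only: mult.assoc)
    also have "\<dots> = (\<Sum>k<?d. (if k = i then ?U k else 0))"
    proof (intro sum.cong refl)
      fix k assume "k \<in> {..<?d}"
      then have "(\<Sum>j<?d. ?Q i j * inv_mat (Q_mat K) $$ (j, k)) = (Q_mat K * inv_mat (Q_mat K)) $$ (i, k)"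
        using i Q_mat_carrier[of K] inv_Q_mat(1)[of K]
        by (auto simp: scalar_prod_def atLeast0LessThan intro!: sum.cong)
      also have "\<dots> = (if k = i then 1 else 0)"
        unfolding inv_Q_mat(2) using i \<open>k \<in> {..<?d}\<close> by auto
      finally show "(\<Sum>j<?d. ?Q i j * inv_mat (Q_mat K) $$ (j, k)) * ?U k = (if k = i then ?U k else 0)" by simp
    qed
    also have "\<dots> = ?U i" using i by (simp only: sum.delta finite_lessThan lessThan_iff if_True)
    finally show "(\<Sum>j<?d. ?Q i j * q j) = ?U i" .
  qed
  have main: "main_term K m p n \<omega> = dot ?d q ?U"
    unfolding main_term_def dot_def q_def sum_distrib_right by (simp only: mult.assoc)
  have "\<bar>bilin ?d ?Q ?b ?b - dot ?d q ?U\<bar> \<le> (2 + B)\<^sup>2 / c\<^sup>2 * ?r ^ 3 \<and>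
    (j < ?d \<longrightarrow> \<bar>?b j\<bar> \<le> (1 + B) / c * ?r)"
  proof (cases "\<omega> \<in> bad_event K p n")
    case True
    then obtain v where v: "bilin ?d ?S v v < c * dot ?d v v" unfolding bad_event_iff c_def by blast
    have "B * (2 + B) / c\<^sup>2 * ?r ^ 3 \<le> (2 + B)\<^sup>2 / c\<^sup>2 * ?r ^ 3"
      using B r0 by (intro mult_right_mono divide_right_mono) (auto simp: power2_eq_square)
    moreover note fallback_system_expansion[OF Q_mat_sym sol coef_error_bad[OF n True] c cQ v r B_def[THEN meta_eq_to_obj_eq]]
    ultimately show ?thesis by (auto intro: order_trans)
  next
    case False
    then have cS: "c * dot ?d v v \<le> bilin ?d ?S v v" for v unfolding bad_event_iff c_def by (simp add: not_less)
    have "(2::real) \<le> (2 + B)\<^sup>2" using B by (simp add: power2_eq_square algebra_simps)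
    then have "2 / c\<^sup>2 * ?r ^ 3 \<le> (2 + B)\<^sup>2 / c\<^sup>2 * ?r ^ 3"
      using r0 by (intro mult_right_mono divide_right_mono) auto
    moreover have "?r / c \<le> (1 + B) / c * ?r"
    proof -
      have "0 \<le> B / c * ?r" using B r0 c by simp
      then show ?thesis by (simp add: add_divide_distrib distrib_right)
    qed
    moreover note coercive_system_expansion[OF Q_mat_sym sol coef_error_good[OF n False] c cQ' cS r]
    ultimately show ?thesis by (auto intro: order_trans)
  qed
  then show "\<bar>bilin ?d ?Q ?b ?b - main_term K m p n \<omega>\<bar> \<le> (2 + B)\<^sup>2 / c\<^sup>2 * ?r ^ 3"
    and "j < ?d \<Longrightarrow> \<bar>?b j\<bar> \<le> (1 + B) / c * ?r"
    unfolding main by auto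
qed

lemma sum_fourth_power_le:
  fixes a :: "'i \<Rightarrow> real"
  assumes "finite I"
  shows "(\<Sum>i\<in>I. a i) ^ 4 \<le> real (card I) ^ 3 * (\<Sum>i\<in>I. a i ^ 4)"
proof -
  have sq: "(\<Sum>i\<in>I. b i)\<^sup>2 \<le> real (card I) * (\<Sum>i\<in>I. (b i)\<^sup>2)" for b :: "'i \<Rightarrow> real"
    using sum_squared_le_sum_of_squares[of b I] by (simp add: mult.commute)
  have "(\<Sum>i\<in>I. a i) ^ 4 = ((\<Sum>i\<in>I. a i)\<^sup>2)\<^sup>2" by (simp flip: power_mult)
  also have "\<dots> \<le> (real (card I) * (\<Sum>i\<in>I. (a i)\<^sup>2))\<^sup>2" by (intro power_mono sq) simp
  also have "\<dots> = (real (card I))\<^sup>2 * (\<Sum>i\<in>I. (a i)\<^sup>2)\<^sup>2" by (simp only: power_mult_distrib)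
  also have "\<dots> \<le> (real (card I))\<^sup>2 * (real (card I) * (\<Sum>i\<in>I. ((a i)\<^sup>2)\<^sup>2))"
    by (intro mult_left_mono sq) simp
  also have "\<dots> = real (card I) ^ 3 * (\<Sum>i\<in>I. a i ^ 4)"
    by (simp only: power_mult[symmetric]) (simp add: power2_eq_square power3_eq_cube)
  finally show ?thesis .
qed

lemma fluctuation_fourth_bound:
  "fluctuation K m p n \<omega> ^ 4 \<le> 8 * real (K + 1) ^ 6 * fluctuation_fourth K m p n \<omega>"
proof -
  let ?d = "K + 1"
  let ?U = "\<lambda>j. sample_mean n (score K m p j) \<omega>" and ?D = "\<lambda>j k. sample_mean n (gram_error K p j k) \<omega>"
  define a where "a = (\<Sum>j<?d. \<bar>?U j\<bar>)"
  define b where "b = (\<Sum>z\<in>{..<?d} \<times> {..<?d}. \<bar>case_prod ?D z\<bar>)"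
  have b_eq: "b = (\<Sum>j<?d. \<Sum>k<?d. \<bar>?D j k\<bar>)"
    unfolding b_def by (simp add: sum.cartesian_product case_prod_unfold del: add_Suc_right)
  have "a ^ 4 \<le> real ?d ^ 3 * (\<Sum>j<?d. ?U j ^ 4)"
    using sum_fourth_power_le[of "{..<?d}" "\<lambda>j. \<bar>?U j\<bar>"] unfolding a_def by (simp add: power_even_abs)
  also have "\<dots> \<le> real ?d ^ 6 * (\<Sum>j<?d. ?U j ^ 4)"
    by (intro mult_right_mono power_increasing sum_nonneg) auto
  finally have A: "a ^ 4 \<le> real ?d ^ 6 * (\<Sum>j<?d. ?U j ^ 4)" .
  have "b ^ 4 \<le> real (?d * ?d) ^ 3 * (\<Sum>z\<in>{..<?d} \<times> {..<?d}. case_prod ?D z ^ 4)"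
    using sum_fourth_power_le[of "{..<?d} \<times> {..<?d}" "\<lambda>z. \<bar>case_prod ?D z\<bar>"]
    unfolding b_def by (simp add: power_even_abs card_cartesian_product)
  also have "(\<Sum>z\<in>{..<?d} \<times> {..<?d}. case_prod ?D z ^ 4) = (\<Sum>j<?d. \<Sum>k<?d. ?D j k ^ 4)"
    by (simp add: sum.cartesian_product case_prod_unfold del: add_Suc_right)
  also have "real (?d * ?d) ^ 3 = real ?d ^ 6"
    by (simp only: of_nat_mult power_mult_distrib flip: power_add) simp
  finally have B: "b ^ 4 \<le> real ?d ^ 6 * (\<Sum>j<?d. \<Sum>k<?d. ?D j k ^ 4)" .
  have "fluctuation K m p n \<omega> ^ 4 = (a + b) ^ 4" unfolding fluctuation_def a_def b_eq ..
  also have "\<dots> \<le> 8 * (a ^ 4 + b ^ 4)" by (rule fourth_power_add_le)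
  also have "\<dots> \<le> 8 * (real ?d ^ 6 * (\<Sum>j<?d. ?U j ^ 4) + real ?d ^ 6 * (\<Sum>j<?d. \<Sum>k<?d. ?D j k ^ 4))"
    by (intro mult_left_mono add_mono A B) simp
  also have "\<dots> = 8 * real ?d ^ 6 * fluctuation_fourth K m p n \<omega>"
    unfolding fluctuation_fourth_def by (simp only: distrib_left mult.assoc)
  finally show ?thesis .
qed


section \<open>Expansion of the integrated risk\<close>

text \<open>The factor by which \<open>indep_sum_moments\<close> turns a bound \<open>B\<close> on the fourth moments of the summands into one on
\<open>n\<^sup>2\<close> times the fourth moment of their mean.\<close>

definition fourth_moment_factor :: "real \<Rightarrow> real" where
  "fourth_moment_factor B = 3 * ((1 + B) / 2)\<^sup>2 + B"

definition fluctuation_const :: "nat \<Rightarrow> (real \<Rightarrow> real) \<Rightarrow> (real \<Rightarrow> real measure) \<Rightarrow> real \<Rightarrow> real" where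
  "fluctuation_const K m \<kappa> \<epsilon> =
     (\<Sum>j<K + 1. fourth_moment_factor (resid_fourth K m \<kappa> / (16 * \<epsilon> ^ 3))) +
     (\<Sum>j<K + 1. \<Sum>k<K + 1. fourth_moment_factor ((1 / (2 * \<epsilon>) + \<bar>Q_mat K $$ (j, k)\<bar>) ^ 4))"

text \<open>The product of the constant in the pointwise remainder bound and the bound for the expectation of
\<open>1 + n\<^sup>2 r\<^sup>4\<close>. The design density does not occur in it.\<close>

definition error_const :: "nat \<Rightarrow> (real \<Rightarrow> real) \<Rightarrow> (real \<Rightarrow> real measure) \<Rightarrow> real \<Rightarrow> real" where
  "error_const K m \<kappa> \<epsilon> =
     (2 + (\<Sum>i<K + 1. \<bar>beta K m $ i\<bar>))\<^sup>2 / (lambda_min (Q_mat K) / 2)\<^sup>2 *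
     (1 + 8 * real (K + 1) ^ 6 * fluctuation_const K m \<kappa> \<epsilon>)"

context sampling_design
begin

abbreviation "law n \<equiv> PiM {..<n} (\<lambda>_. P)"

lemma prob_space_law: "prob_space (law n)"
  by (intro prob_space_PiM prob_space_P)

lemma score_moments:
  assumes n: "n \<ge> 1" and j: "j < K + 1"
  shows "integrable (law n) (\<lambda>\<omega>. sample_mean n (score K m p j) \<omega> ^ 4)"
    and "(LINT \<omega>|law n. sample_mean n (score K m p j) \<omega> ^ 4)
      \<le> fourth_moment_factor (resid_fourth K m \<kappa> / (16 * \<epsilon> ^ 3)) / (real n)\<^sup>2"
  unfolding fourth_moment_factor_def
  by (rule sample_mean_moments[OF prob_space_P n _ score_fourth(1) score_mean[OF j] score_fourth(2)], measurable)+

lemma gram_error_moments: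
  assumes n: "n \<ge> 1" and jk: "j < K + 1" "k < K + 1"
  shows "integrable (law n) (\<lambda>\<omega>. sample_mean n (gram_error K p j k) \<omega> ^ 4)"
    and "(LINT \<omega>|law n. sample_mean n (gram_error K p j k) \<omega> ^ 4)
      \<le> fourth_moment_factor ((1 / (2 * \<epsilon>) + \<bar>Q_mat K $$ (j, k)\<bar>) ^ 4) / (real n)\<^sup>2"
  unfolding fourth_moment_factor_def
  by (rule sample_mean_moments[OF prob_space_P n _ gram_error_fourth(1) gram_error_mean[OF jk] gram_error_fourth(2)], measurable)+

lemma fluctuation_fourth_moment:
  assumes n: "n \<ge> 1"
  shows "integrable (law n) (fluctuation_fourth K m p n)"
    and "(LINT \<omega>|law n. fluctuation_fourth K m p n \<omega>) \<le> fluctuation_const K m \<kappa> \<epsilon> / (real n)\<^sup>2"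
proof -
  have i1: "integrable (law n) (\<lambda>\<omega>. \<Sum>j<K + 1. sample_mean n (score K m p j) \<omega> ^ 4)"
    by (intro Bochner_Integration.integrable_sum score_moments(1)[OF n]) simp
  have i2: "integrable (law n) (\<lambda>\<omega>. \<Sum>j<K + 1. \<Sum>k<K + 1. sample_mean n (gram_error K p j k) \<omega> ^ 4)"
    by (intro Bochner_Integration.integrable_sum gram_error_moments(1)[OF n]) simp_all
  show "integrable (law n) (fluctuation_fourth K m p n)"
    unfolding fluctuation_fourth_def[abs_def] by (rule Bochner_Integration.integrable_add[OF i1 i2])
  have "(LINT \<omega>|law n. fluctuation_fourth K m p n \<omega>) =
      (LINT \<omega>|law n. (\<Sum>j<K + 1. sample_mean n (score K m p j) \<omega> ^ 4)) +
      (LINT \<omega>|law n. (\<Sum>j<K + 1. \<Sum>k<K + 1. sample_mean n (gram_error K p j k) \<omega> ^ 4))"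
    unfolding fluctuation_fourth_def by (rule Bochner_Integration.integral_add[OF i1 i2])
  also have "(LINT \<omega>|law n. (\<Sum>j<K + 1. sample_mean n (score K m p j) \<omega> ^ 4)) =
      (\<Sum>j<K + 1. (LINT \<omega>|law n. sample_mean n (score K m p j) \<omega> ^ 4))"
    by (rule Bochner_Integration.integral_sum) (rule score_moments(1)[OF n], simp)
  also have "(LINT \<omega>|law n. (\<Sum>j<K + 1. \<Sum>k<K + 1. sample_mean n (gram_error K p j k) \<omega> ^ 4)) =
      (\<Sum>j<K + 1. (LINT \<omega>|law n. (\<Sum>k<K + 1. sample_mean n (gram_error K p j k) \<omega> ^ 4)))"
    by (rule Bochner_Integration.integral_sum)
       (intro Bochner_Integration.integrable_sum gram_error_moments(1)[OF n], simp_all)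
  also have "\<dots> = (\<Sum>j<K + 1. \<Sum>k<K + 1. (LINT \<omega>|law n. sample_mean n (gram_error K p j k) \<omega> ^ 4))"
    by (intro sum.cong refl Bochner_Integration.integral_sum gram_error_moments(1)[OF n]) simp_all
  also have "(\<Sum>j<K + 1. (LINT \<omega>|law n. sample_mean n (score K m p j) \<omega> ^ 4)) +
      (\<Sum>j<K + 1. \<Sum>k<K + 1. (LINT \<omega>|law n. sample_mean n (gram_error K p j k) \<omega> ^ 4)) \<le>
      (\<Sum>j<K + 1. fourth_moment_factor (resid_fourth K m \<kappa> / (16 * \<epsilon> ^ 3)) / (real n)\<^sup>2) +
      (\<Sum>j<K + 1. \<Sum>k<K + 1. fourth_moment_factor ((1 / (2 * \<epsilon>) + \<bar>Q_mat K $$ (j, k)\<bar>) ^ 4) / (real n)\<^sup>2)"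
    by (intro add_mono sum_mono score_moments(2)[OF n] gram_error_moments(2)[OF n]) simp_all
  also have "\<dots> = fluctuation_const K m \<kappa> \<epsilon> / (real n)\<^sup>2"
    unfolding fluctuation_const_def by (simp only: sum_divide_distrib add_divide_distrib)
  finally show "(LINT \<omega>|law n. fluctuation_fourth K m p n \<omega>) \<le> fluctuation_const K m \<kappa> \<epsilon> / (real n)\<^sup>2" .
qed

lemma coordinate_meas [measurable]:
  assumes "i < n"
  shows "(\<lambda>\<omega>. \<omega> i) \<in> law n \<rightarrow>\<^sub>M Leb \<Otimes>\<^sub>M borel"
proof -
  have "(\<lambda>\<omega>. \<omega> i) \<in> law n \<rightarrow>\<^sub>M P"
    by (rule measurable_component_singleton) (use assms in simp)
  then show ?thesis by (simp cong: measurable_cong_sets add: sets_P)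
qed

lemma gram_entry_meas:
  assumes "j < K + 1" "k < K + 1"
  shows "(\<lambda>\<omega>. gram K p n \<omega> $$ (j, k)) \<in> borel_measurable (law n)"
  unfolding gram_entry[OF assms]
proof (rule borel_measurable_sum)
  fix i assume "i \<in> {..<n}"
  then have "i < n" by simp
  note [measurable] = coordinate_meas[OF this]
  show "(\<lambda>\<omega>. 1 / 2 / p (fst (\<omega> i)) * fst (\<omega> i) ^ (j + k)) \<in> borel_measurable (law n)" by measurable
qed

lemma V_tilde_entry_meas:
  assumes "j < K + 1"
  shows "(\<lambda>\<omega>. V_tilde K m p n \<omega> $ j) \<in> borel_measurable (law n)"
  unfolding V_tilde_entry[OF assms]
proof (rule borel_measurable_sum)
  fix i assume "i \<in> {..<n}"
  then have "i < n" by simp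
  note [measurable] = coordinate_meas[OF this]
  show "(\<lambda>\<omega>. fst (\<omega> i) ^ j * (1 / 2 / p (fst (\<omega> i))) * response m (\<omega> i)) \<in> borel_measurable (law n)"
    unfolding response_def case_prod_unfold by measurable
qed

text \<open>The event is a countable union, over rational \<open>v\<close>, of strict inequalities between functions that are linear in
the Gram matrix.\<close>

lemma bad_event_meas: "Measurable.pred (law n) (\<lambda>\<omega>. \<omega> \<in> bad_event K p n)"
proof -
  let ?c = "lambda_min (Q_mat K) / 2"
  have eq: "\<omega> \<in> bad_event K p n \<longleftrightarrow>
    (\<exists>v\<in>(\<Pi>\<^sub>E i\<in>{..<K + 1}. \<rat>). bilin (K + 1) (entries (mean_gram K p n \<omega>)) v v < ?c * dot (K + 1) v v)" for \<omega>
    unfolding bad_event_iff using rational_quadratic_witness by blast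
  have count: "countable (\<Pi>\<^sub>E i\<in>{..<K + 1}. \<rat> :: real set)"
    by (intro countable_PiE countable_rat) auto
  have "(\<lambda>\<omega>. bilin (K + 1) (entries (mean_gram K p n \<omega>)) v v) \<in> borel_measurable (law n)" for v
    unfolding bilin_def
  proof (intro borel_measurable_sum)
    fix i j assume "i \<in> {..<K + 1}" "j \<in> {..<K + 1}"
    then have ij: "i < K + 1" "j < K + 1" by auto
    have "entries (mean_gram K p n \<omega>) i j = 1 / real n * gram K p n \<omega> $$ (i, j)" for \<omega>
      using gram_carrier[of K p n \<omega>] ij by simp
    then show "(\<lambda>\<omega>. v i * entries (mean_gram K p n \<omega>) i j * v j) \<in> borel_measurable (law n)"
      using gram_entry_meas[OF ij] by simp
  qed
  then have pv: "Measurable.pred (law n) (\<lambda>\<omega>. bilin (K + 1) (entries (mean_gram K p n \<omega>)) v v < ?c * dot (K + 1) v v)" for v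
    by (rule borel_measurable_pred_less) simp
  show ?thesis
    unfolding eq pred_def by (intro sets.sets_Collect_countable_Ex' count pv[unfolded pred_def])
qed

lemma beta_tilde_entry_meas:
  assumes n: "n \<ge> 1" and j: "j < K + 1"
  shows "(\<lambda>\<omega>. beta_tilde K m p n \<omega> $ j) \<in> borel_measurable (law n)"
proof -
  let ?R = "real n \<cdot>\<^sub>m Q_mat K"
  have eq: "beta_tilde K m p n \<omega> $ j = (if \<omega> \<in> bad_event K p n
      then \<Sum>k<K + 1. inv_mat ?R $$ (j, k) * V_tilde K m p n \<omega> $ k
      else \<Sum>k<K + 1. adj_mat (gram K p n \<omega>) $$ (j, k) / det (gram K p n \<omega>) * V_tilde K m p n \<omega> $ k)" for \<omega>
  proof -
    note Q = Q_tilde_inverse[OF n, of K p \<omega>]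
    have "beta_tilde K m p n \<omega> $ j = (\<Sum>k<K + 1. inv_mat (Q_tilde K p n \<omega>) $$ (j, k) * V_tilde K m p n \<omega> $ k)"
      unfolding beta_tilde_def by (rule mult_mat_vec_entry[OF Q(2) V_tilde_carrier j])
    also have "\<dots> = (if \<omega> \<in> bad_event K p n
      then \<Sum>k<K + 1. inv_mat ?R $$ (j, k) * V_tilde K m p n \<omega> $ k
      else \<Sum>k<K + 1. adj_mat (gram K p n \<omega>) $$ (j, k) / det (gram K p n \<omega>) * V_tilde K m p n \<omega> $ k)"
    proof (cases "\<omega> \<in> bad_event K p n")
      case True
      then show ?thesis unfolding Q_tilde_def by simp
    next
      case False
      then have "Q_tilde K p n \<omega> = gram K p n \<omega>" unfolding Q_tilde_def by simp
      with Q have "inv_mat (Q_tilde K p n \<omega>) $$ (j, k) = adj_mat (gram K p n \<omega>) $$ (j, k) / det (gram K p n \<omega>)"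
        if "k < K + 1" for k
        using inverse_eq_adj_mat[OF Q(1,2,4,5) j that] by simp
      with False show ?thesis by (auto intro!: sum.cong)
    qed
    finally show ?thesis .
  qed
  have [measurable]: "(\<lambda>\<omega>. det (gram K p n \<omega>)) \<in> borel_measurable (law n)"
    by (rule det_measurable[OF gram_carrier gram_entry_meas])
  show ?thesis
    unfolding eq
  proof (rule measurable_If[OF _ _ bad_event_meas[unfolded pred_def]])
    show "(\<lambda>\<omega>. \<Sum>k<K + 1. inv_mat ?R $$ (j, k) * V_tilde K m p n \<omega> $ k) \<in> borel_measurable (law n)"
      by (intro borel_measurable_sum borel_measurable_times V_tilde_entry_meas) auto
    show "(\<lambda>\<omega>. \<Sum>k<K + 1. adj_mat (gram K p n \<omega>) $$ (j, k) / det (gram K p n \<omega>) * V_tilde K m p n \<omega> $ k)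
        \<in> borel_measurable (law n)"
    proof (intro borel_measurable_sum borel_measurable_times borel_measurable_divide V_tilde_entry_meas)
      fix k assume "k \<in> {..<K + 1}"
      then have k: "k < K + 1" by simp
      then show "k < K + 1" .
      show "(\<lambda>\<omega>. adj_mat (gram K p n \<omega>) $$ (j, k)) \<in> borel_measurable (law n)"
        by (rule adj_mat_measurable[OF gram_carrier gram_entry_meas j k])
    qed measurable
  qed
qed

lemma coef_error_meas:
  assumes "n \<ge> 1" "j < K + 1"
  shows "(\<lambda>\<omega>. coef_error K m p n \<omega> j) \<in> borel_measurable (law n)"
  unfolding coef_error_def using beta_tilde_entry_meas[OF assms] by simp

text \<open>The errors are at most linear in the fluctuation \<open>r\<close>, so their products are dominated by \<open>r\<^sup>2 \<le> 1 + r\<^sup>4\<close>.\<close>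

lemma coef_error_product_integrable:
  assumes n: "n \<ge> 1" and j: "j < K + 1" and k: "k < K + 1"
  shows "integrable (law n) (\<lambda>\<omega>. coef_error K m p n \<omega> j * coef_error K m p n \<omega> k)"
proof -
  interpret L: prob_space "law n" by (rule prob_space_law)
  define A where "A = (1 + (\<Sum>i<K + 1. \<bar>beta K m $ i\<bar>)) / (lambda_min (Q_mat K) / 2)"
  show ?thesis
  proof (rule Bochner_Integration.integrable_bound)
    show "integrable (law n) (\<lambda>\<omega>. A\<^sup>2 * (1 + 8 * real (K + 1) ^ 6 * fluctuation_fourth K m p n \<omega>))"
      using fluctuation_fourth_moment(1)[OF n] by simp
    show "(\<lambda>\<omega>. coef_error K m p n \<omega> j * coef_error K m p n \<omega> k) \<in> borel_measurable (law n)"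
      by (intro borel_measurable_times coef_error_meas assms)
    show "AE \<omega> in law n. norm (coef_error K m p n \<omega> j * coef_error K m p n \<omega> k)
      \<le> norm (A\<^sup>2 * (1 + 8 * real (K + 1) ^ 6 * fluctuation_fourth K m p n \<omega>))"
    proof (rule AE_I2)
      fix \<omega>
      let ?r = "fluctuation K m p n \<omega>"
      note b = coef_error_expansion(2)[OF n, of _ K m p \<omega>, folded A_def]
      have "\<bar>coef_error K m p n \<omega> j * coef_error K m p n \<omega> k\<bar> \<le> (A * ?r) * (A * ?r)"
        unfolding abs_mult by (intro mult_mono b[OF j] b[OF k]) (use b[OF j] in auto)
      also have "\<dots> = A\<^sup>2 * ?r\<^sup>2" by (simp add: power2_eq_square)
      also have "\<dots> \<le> A\<^sup>2 * (1 + 8 * real (K + 1) ^ 6 * fluctuation_fourth K m p n \<omega>)"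
        using abs_power_le_one_plus_fourth[of 2 ?r] fluctuation_fourth_bound[of K m p n \<omega>]
        by (intro mult_left_mono) auto
      also have "\<dots> \<le> \<bar>A\<^sup>2 * (1 + 8 * real (K + 1) ^ 6 * fluctuation_fourth K m p n \<omega>)\<bar>" by (rule abs_ge_self)
      finally show "norm (coef_error K m p n \<omega> j * coef_error K m p n \<omega> k)
        \<le> norm (A\<^sup>2 * (1 + 8 * real (K + 1) ^ 6 * fluctuation_fourth K m p n \<omega>))" by simp
    qed
  qed
qed

lemma ell_tilde_minus_ell:
  assumes n: "n \<ge> 1"
  shows "ell_tilde K m p n \<omega> x - ell K m x = (\<Sum>j<K + 1. x ^ j * coef_error K m p n \<omega> j)"
  unfolding ell_tilde_def powers_scalar_prod[OF beta_tilde_carrier[OF n]] ell_eq coef_error_def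
  by (simp only: right_diff_distrib sum_subtractf)

lemma integrated_risk:
  assumes n: "n \<ge> 1"
  shows "(LINT x|Leb. 1/2 * (LINT \<omega>|law n. (ell_tilde K m p n \<omega> x - ell K m x)\<^sup>2)) =
    (LINT \<omega>|law n. bilin (K + 1) (entries (Q_mat K)) (coef_error K m p n \<omega>) (coef_error K m p n \<omega>))"
proof -
  let ?b = "\<lambda>\<omega>. coef_error K m p n \<omega>"
  define E where "E j k = (LINT \<omega>|law n. ?b \<omega> j * ?b \<omega> k)" for j k
  note ib = coef_error_product_integrable[OF n]
  have sq: "(ell_tilde K m p n \<omega> x - ell K m x)\<^sup>2 = (\<Sum>j<K + 1. \<Sum>k<K + 1. x ^ (j + k) * (?b \<omega> j * ?b \<omega> k))" for \<omega> x
    unfolding ell_tilde_minus_ell[OF n] power2_eq_square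
    by (simp only: sum_product, simp only: power_add mult_ac)
  have inner: "(LINT \<omega>|law n. (ell_tilde K m p n \<omega> x - ell K m x)\<^sup>2) = (\<Sum>j<K + 1. \<Sum>k<K + 1. x ^ (j + k) * E j k)" for x
  proof -
    have "(LINT \<omega>|law n. (ell_tilde K m p n \<omega> x - ell K m x)\<^sup>2) =
        (\<Sum>j<K + 1. (LINT \<omega>|law n. (\<Sum>k<K + 1. x ^ (j + k) * (?b \<omega> j * ?b \<omega> k))))"
      unfolding sq by (intro Bochner_Integration.integral_sum Bochner_Integration.integrable_sum integrable_mult_right ib) simp_all
    also have "\<dots> = (\<Sum>j<K + 1. \<Sum>k<K + 1. (LINT \<omega>|law n. x ^ (j + k) * (?b \<omega> j * ?b \<omega> k)))"
      by (intro sum.cong refl Bochner_Integration.integral_sum integrable_mult_right ib) simp_all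
    finally show ?thesis unfolding E_def by (simp only: integral_mult_right_zero)
  qed
  have ip: "integrable Leb (\<lambda>x. (1/2 * x ^ (j + k)) * E j k)" for j k
    by (intro integrable_mult_left integrable_mult_right integrable_Leb_power)
  have "(LINT x|Leb. 1/2 * (LINT \<omega>|law n. (ell_tilde K m p n \<omega> x - ell K m x)\<^sup>2)) =
      (LINT x|Leb. (\<Sum>j<K + 1. \<Sum>k<K + 1. (1/2 * x ^ (j + k)) * E j k))"
    unfolding inner by (simp only: sum_distrib_left mult.assoc)
  also have "\<dots> = (\<Sum>j<K + 1. (LINT x|Leb. (\<Sum>k<K + 1. (1/2 * x ^ (j + k)) * E j k)))"
    by (intro Bochner_Integration.integral_sum Bochner_Integration.integrable_sum ip)
  also have "\<dots> = (\<Sum>j<K + 1. \<Sum>k<K + 1. (LINT x|Leb. (1/2 * x ^ (j + k)) * E j k))"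
    by (intro sum.cong refl Bochner_Integration.integral_sum ip)
  also have "\<dots> = (\<Sum>j<K + 1. \<Sum>k<K + 1. Q_mat K $$ (j, k) * E j k)"
    by (intro sum.cong refl) (simp only: Q_mat_entry lessThan_iff integral_mult_left_zero)
  also have "\<dots> = (\<Sum>j<K + 1. \<Sum>k<K + 1. (LINT \<omega>|law n. Q_mat K $$ (j, k) * (?b \<omega> j * ?b \<omega> k)))"
    unfolding E_def by (simp only: integral_mult_right_zero)
  also have "\<dots> = (\<Sum>j<K + 1. (LINT \<omega>|law n. (\<Sum>k<K + 1. Q_mat K $$ (j, k) * (?b \<omega> j * ?b \<omega> k))))"
    by (intro sum.cong refl Bochner_Integration.integral_sum[symmetric] integrable_mult_right ib) simp_all
  also have "\<dots> = (LINT \<omega>|law n. (\<Sum>j<K + 1. \<Sum>k<K + 1. Q_mat K $$ (j, k) * (?b \<omega> j * ?b \<omega> k)))"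
    by (intro Bochner_Integration.integral_sum[symmetric] Bochner_Integration.integrable_sum integrable_mult_right ib) simp_all
  also have "\<dots> = (LINT \<omega>|law n. bilin (K + 1) (entries (Q_mat K)) (?b \<omega>) (?b \<omega>))"
    unfolding bilin_def by (simp only: mult_ac)
  finally show ?thesis .
qed

lemma risk_integrable:
  assumes n: "n \<ge> 1"
  shows "integrable (law n) (\<lambda>\<omega>. bilin (K + 1) (entries (Q_mat K)) (coef_error K m p n \<omega>) (coef_error K m p n \<omega>))"
proof -
  have "integrable (law n) (\<lambda>\<omega>. \<Sum>j<K + 1. \<Sum>k<K + 1. Q_mat K $$ (j, k) * (coef_error K m p n \<omega> j * coef_error K m p n \<omega> k))"
    by (intro Bochner_Integration.integrable_sum integrable_mult_right coef_error_product_integrable[OF n]) simp_all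
  then show ?thesis unfolding bilin_def by (simp only: mult_ac)
qed

lemma Omega_entry:
  assumes "j < K + 1" "k < K + 1"
  shows "Omega K m \<kappa> p $$ (j, k) = (LINT z|P. score K m p j z * score K m p k z)"
proof -
  let ?Z = "\<lambda>z. (resid K m z * ((1/2) / p (fst z))) \<cdot>\<^sub>v powers K (fst z)"
  have Z: "?Z z $ i = score K m p i z" if "i < K + 1" for i z
    using that unfolding score_def by (simp add: powers_entry) (simp add: powers_def)
  show ?thesis
    unfolding Omega_def cov_mat_def using assms by (simp only: index_mat(1) case_prod_conv Z score_mean diff_zero)
qed

text \<open>The scores are centred, so \<open>E U\<^sub>k U\<^sub>j\<close> is the covariance \<open>\<Omega>\<^sub>k\<^sub>j / n\<close>, and summing against \<open>Q\<^sup>-\<^sup>1\<close> produces the trace.\<close>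

lemma main_term_expectation:
  assumes n: "n \<ge> 1"
  shows "integrable (law n) (main_term K m p n)"
    and "(LINT \<omega>|law n. main_term K m p n \<omega>) = 1 / real n * tr (inv_mat (Q_mat K) * Omega K m \<kappa> p)"
proof -
  let ?G = "inv_mat (Q_mat K)"
  let ?s = "\<lambda>j. sample_mean n (score K m p j)"
  have meas: "score K m p j \<in> borel_measurable P" for j
    using score_meas[of j] by (simp cong: measurable_cong_sets add: sets_P)
  have cov: "integrable (law n) (\<lambda>\<omega>. ?s k \<omega> * ?s j \<omega>)"
    "(LINT \<omega>|law n. ?s k \<omega> * ?s j \<omega>) = Omega K m \<kappa> p $$ (k, j) / real n" if "j < K + 1" "k < K + 1" for j k
    using sample_mean_covariance[OF prob_space_P n meas meas score_fourth(1) score_fourth(1) score_mean[OF that(2)] score_mean[OF that(1)]]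
      Omega_entry[OF that(2,1)] by auto
  show "integrable (law n) (main_term K m p n)"
    unfolding main_term_def[abs_def]
    by (intro Bochner_Integration.integrable_sum integrable_mult_right cov) simp_all
  have "(LINT \<omega>|law n. main_term K m p n \<omega>) =
      (\<Sum>j<K + 1. (LINT \<omega>|law n. (\<Sum>k<K + 1. ?G $$ (j, k) * (?s k \<omega> * ?s j \<omega>))))"
    unfolding main_term_def
    by (intro Bochner_Integration.integral_sum Bochner_Integration.integrable_sum integrable_mult_right cov) simp_all
  also have "\<dots> = (\<Sum>j<K + 1. \<Sum>k<K + 1. (LINT \<omega>|law n. ?G $$ (j, k) * (?s k \<omega> * ?s j \<omega>)))"
    by (intro sum.cong refl Bochner_Integration.integral_sum integrable_mult_right cov) simp_all
  also have "\<dots> = (\<Sum>j<K + 1. \<Sum>k<K + 1. 1 / real n * (?G $$ (j, k) * Omega K m \<kappa> p $$ (k, j)))"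
    by (intro sum.cong refl) (simp only: integral_mult_right_zero cov lessThan_iff, simp)
  also have "\<dots> = 1 / real n * (\<Sum>j<K + 1. \<Sum>k<K + 1. ?G $$ (j, k) * Omega K m \<kappa> p $$ (k, j))"
    by (simp only: sum_distrib_left)
  also have "(\<Sum>j<K + 1. \<Sum>k<K + 1. ?G $$ (j, k) * Omega K m \<kappa> p $$ (k, j)) = tr (?G * Omega K m \<kappa> p)"
  proof -
    have O: "Omega K m \<kappa> p \<in> carrier_mat (K + 1) (K + 1)" unfolding Omega_def cov_mat_def by simp
    have "(?G * Omega K m \<kappa> p) $$ (j, j) = (\<Sum>k<K + 1. ?G $$ (j, k) * Omega K m \<kappa> p $$ (k, j))" if "j < K + 1" for j
      using inv_Q_mat(1)[of K] O that by (auto simp: scalar_prod_def atLeast0LessThan intro!: sum.cong)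
    then show ?thesis using inv_Q_mat(1)[of K] unfolding tr_def by (auto intro!: sum.cong)
  qed
  finally show "(LINT \<omega>|law n. main_term K m p n \<omega>) = 1 / real n * tr (?G * Omega K m \<kappa> p)" .
qed

text \<open>The power \<open>n\<^sup>3\<^sup>/\<^sup>2\<close> is \<open>s\<^sup>3\<close> with \<open>s = n\<^sup>1\<^sup>/\<^sup>2\<close>. Multiplied with the cubic remainder it gives \<open>(s r)\<^sup>3 \<le> 1 + (s r)\<^sup>4\<close>, and
\<open>s\<^sup>4 E r\<^sup>4\<close> is bounded because \<open>r\<close> consists of sample means.\<close>

lemma risk_expansion:
  assumes n: "n \<ge> 1"
  shows "real n powr (3/2) *
      \<bar>(LINT x|Leb. 1/2 * (LINT \<omega>|law n. (ell_tilde K m p n \<omega> x - ell K m x)\<^sup>2))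
        - 1 / real n * tr (inv_mat (Q_mat K) * Omega K m \<kappa> p)\<bar> \<le> error_const K m \<kappa> \<epsilon>"
proof -
  interpret L: prob_space "law n" by (rule prob_space_law)
  define A where "A = (2 + (\<Sum>i<K + 1. \<bar>beta K m $ i\<bar>))\<^sup>2 / (lambda_min (Q_mat K) / 2)\<^sup>2"
  define N where "N = 8 * real (K + 1) ^ 6"
  define s where "s = sqrt (real n)"
  have A0: "0 \<le> A" unfolding A_def by simp
  have N0: "0 \<le> N" unfolding N_def by simp
  have s: "s > 0" "s\<^sup>2 = real n" using n unfolding s_def by auto
  have s4: "s ^ 4 = (real n)\<^sup>2"
    unfolding s(2)[symmetric] by (simp flip: power_mult)
  have s3: "real n powr (3/2) = s ^ 3"
  proof -
    have "s ^ 3 = s powr 3" using s(1) by (simp add: powr_numeral)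
    also have "\<dots> = (real n powr (1/2)) powr 3" unfolding s_def by (simp add: powr_half_sqrt)
    finally show ?thesis by (simp add: powr_powr)
  qed
  let ?D = "\<lambda>\<omega>. bilin (K + 1) (entries (Q_mat K)) (coef_error K m p n \<omega>) (coef_error K m p n \<omega>)"
  let ?M = "main_term K m p n" and ?F = "fluctuation_fourth K m p n" and ?r = "fluctuation K m p n"
  have F: "integrable (law n) ?F" "(LINT \<omega>|law n. ?F \<omega>) \<le> fluctuation_const K m \<kappa> \<epsilon> / (real n)\<^sup>2"
    using fluctuation_fourth_moment[OF n] by auto
  have point: "s ^ 3 * \<bar>?D \<omega> - ?M \<omega>\<bar> \<le> A * (1 + N * (real n)\<^sup>2 * ?F \<omega>)" for \<omega>
  proof -
    have "s ^ 3 * \<bar>?D \<omega> - ?M \<omega>\<bar> \<le> s ^ 3 * (A * ?r \<omega> ^ 3)"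
      using coef_error_expansion(1)[OF n, of K m p \<omega>, folded A_def] s(1) by (intro mult_left_mono) auto
    also have "\<dots> = A * (s * ?r \<omega>) ^ 3" by (simp add: power_mult_distrib)
    also have "\<dots> \<le> A * (1 + (s * ?r \<omega>) ^ 4)"
      using abs_power_le_one_plus_fourth[of 3 "s * ?r \<omega>"] A0 by (intro mult_left_mono) auto
    also have "\<dots> = A * (1 + (real n)\<^sup>2 * ?r \<omega> ^ 4)" by (simp add: power_mult_distrib s4)
    also have "\<dots> \<le> A * (1 + (real n)\<^sup>2 * (N * ?F \<omega>))"
      using fluctuation_fourth_bound[of K m p n \<omega>, folded N_def] A0
      by (intro mult_left_mono add_left_mono) auto
    finally show ?thesis by (simp add: mult_ac)
  qed
  have iD: "integrable (law n) ?D" by (rule risk_integrable[OF n])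
  have iM: "integrable (law n) ?M" by (rule main_term_expectation[OF n])
  have "s ^ 3 * \<bar>(LINT \<omega>|law n. ?D \<omega>) - (LINT \<omega>|law n. ?M \<omega>)\<bar> = s ^ 3 * \<bar>LINT \<omega>|law n. ?D \<omega> - ?M \<omega>\<bar>"
    using iD iM by simp
  also have "\<dots> \<le> s ^ 3 * (LINT \<omega>|law n. \<bar>?D \<omega> - ?M \<omega>\<bar>)"
    using s(1) by (intro mult_left_mono integral_abs_bound) simp
  also have "\<dots> = (LINT \<omega>|law n. s ^ 3 * \<bar>?D \<omega> - ?M \<omega>\<bar>)" by simp
  also have "\<dots> \<le> (LINT \<omega>|law n. A * (1 + N * (real n)\<^sup>2 * ?F \<omega>))"
    using iD iM F(1) point by (intro integral_mono) auto
  also have "\<dots> = A * (1 + N * (real n)\<^sup>2 * (LINT \<omega>|law n. ?F \<omega>))"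
    using F(1) by (simp add: L.prob_space)
  also have "\<dots> \<le> A * (1 + N * (real n)\<^sup>2 * (fluctuation_const K m \<kappa> \<epsilon> / (real n)\<^sup>2))"
    using F(2) A0 N0 by (intro mult_left_mono add_left_mono) auto
  also have "\<dots> = error_const K m \<kappa> \<epsilon>"
    using n unfolding error_const_def A_def N_def by simp
  finally show ?thesis unfolding s3 integrated_risk[OF n] main_term_expectation(2)[OF n] .
qed

end

theorem theorem1:
  fixes K :: nat and \<epsilon>\<^sub>0 \<sigma> :: real
    and m :: "real \<Rightarrow> real" and \<kappa> :: "real \<Rightarrow> real measure"
  assumes "K \<ge> 1" and "\<epsilon>\<^sub>0 > 0"
    and "integrable Leb m"
    and "noise_kernel \<kappa> \<sigma>"
  shows "\<exists>C::real. \<forall>(p::real \<Rightarrow> real) (n::nat).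
    density_on_interval p \<longrightarrow> (\<forall>x\<in>{-1..1}. p x > \<epsilon>\<^sub>0) \<longrightarrow>
    integrable (pair_law p \<kappa>) (\<lambda>z. resid K m z ^ 4) \<longrightarrow> n \<ge> 1 \<longrightarrow>
    real n powr (3/2) *
      \<bar>(LINT x|Leb. 1/2 * (LINT \<omega>|sample_law p \<kappa> n. (ell_tilde K m p n \<omega> x - ell K m x)\<^sup>2))
        - 1 / real n * tr (inv_mat (Q_mat K) * Omega K m \<kappa> p)\<bar> < C"
\<comment> \<open>the added 1 only makes the inequality strict\<close>
proof (intro exI[of _ "error_const K m \<kappa> \<epsilon>\<^sub>0 + 1"] allI impI)
  fix p :: "real \<Rightarrow> real" and n :: nat
  assume p: "density_on_interval p" "\<forall>x\<in>{-1..1}. p x > \<epsilon>\<^sub>0"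
    "integrable (pair_law p \<kappa>) (\<lambda>z. resid K m z ^ 4)" and n: "n \<ge> 1"
  interpret sampling_design K \<epsilon>\<^sub>0 m \<kappa> p
    by unfold_locales (use assms p in \<open>auto simp: noise_kernel_def density_on_interval_def\<close>)
  show "real n powr (3/2) *
      \<bar>(LINT x|Leb. 1/2 * (LINT \<omega>|sample_law p \<kappa> n. (ell_tilde K m p n \<omega> x - ell K m x)\<^sup>2))
        - 1 / real n * tr (inv_mat (Q_mat K) * Omega K m \<kappa> p)\<bar> < error_const K m \<kappa> \<epsilon>\<^sub>0 + 1"
    using risk_expansion[OF n] unfolding sample_law_def by linarith
qed

end
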